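(* Let $n\ge3$, $1<k<n/2$. (i) If $p=p_{so}=\frac{(n+2)k}{n-2k}$, or if $p\ge\max\{p^*,p_{jl}\}$ with $p^*=k\frac{n+2k}{n-2k}$, then every regular solution of (1.6) is a stable solution of (1.1) on $(R,\infty)$ for some $R>0$. (ii) If $p_{se}=\frac{nk}{n-2k}<p<p_{so}$ and $U_s$ is a positive $C^1(0,\infty)$ solution of (1.1) such that $U_s(r)/u_s(r)\to1$ as $r\to0$ and $U_s(r)r^{\frac{n-2k}{k}}\to\lambda$ as $r\to\infty$ for some $\lambda>0$, where $u_s(r)=Ar^{-\frac{2k}{p-k}}$ with $A=(\tfrac1kC_{n-1}^{k-1})^{\frac{1}{p-k}}(\tfrac{2k}{p-k})^{\frac{k}{p-k}}(n-\tfrac{2pk}{p-k})^{\frac{1}{p-k}}$, then $U_s$ is a stable solution of (1.1) on $(R,\infty)$ for some $R>0$.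
   Context: Equation (1.1) is $$-\tfrac{1}{k}C_{n-1}^{k-1}\big(r^{n-k}|u'|^{k-1}u'\big)'=r^{n-1}u^{p},\qquad u(r)>0 \text{ for } r>0,$$ with $C_{n-1}^{k-1}$ the binomial coefficient. Problem (1.6) is (1.1) together with $u'(0)=0$, $u(0)=\rho>0$; a solution of (1.6) is regular if $x\mapsto u(|x|)$ is in $C^2(\mathbb{R}^n)$. The Joseph–Lundgren exponent is $p_{jl}=\infty$ if $n\le 2k+8$, and $p_{jl}=\frac{k[n^2-2(k+3)n+4k]+4k\sqrt{2(k+1)n-4k}}{(n-2k)(n-2k-8)}$ if $n>2k+8$. Let $W_*=\{\varphi:(0,\infty)\to\mathbb{R} : \varphi(|x|)=\phi(x) \text{ for some radial } \phi\in C_c^\infty(\mathbb{R}^n)\}$ and $$Q_u(\varphi):=C_{n-1}^{k-1}\int_0^\infty r^{n-k}|u'|^{k-1}(\varphi')^2dr-p\int_0^\infty r^{n-1}u^{p-1}\varphi^2dr.$$ A positive solution $u\in C^1(0,\infty)$ of (1.1) is stable on $(R,\infty)$ if $\int_0^\infty[\tfrac1k C_{n-1}^{k-1}r^{n-k}|u'|^{k-1}u'\varphi'-r^{n-1}u^p\varphi]dr=0$ for all $\varphi\in W_*$ and $Q_u(\varphi)\ge0$ for all $\varphi\in C_c^\infty(R,\infty)$. *)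

theory Defs
  imports "HOL-Analysis.Analysis"
begin

fun Ck :: "nat \<Rightarrow> ('a::euclidean_space \<Rightarrow> real) \<Rightarrow> bool" where
  "Ck 0 f = continuous_on UNIV f"
| "Ck (Suc m) f = ((\<forall>x. f differentiable (at x)) \<and>
      (\<forall>i\<in>Basis. Ck m (\<lambda>x. frechet_derivative f (at x) i)))"

definition smooth :: "('a::euclidean_space \<Rightarrow> real) \<Rightarrow> bool" where
  "smooth f \<longleftrightarrow> (\<forall>m. Ck m f)"

definition Cnk :: "nat \<Rightarrow> nat \<Rightarrow> real" where
  "Cnk n k = real ((n - 1) choose (k - 1))"

definition is_sol :: "nat \<Rightarrow> nat \<Rightarrow> real \<Rightarrow> (real \<Rightarrow> real) \<Rightarrow> bool" where
  "is_sol n k p u \<longleftrightarrow>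
     (\<forall>r>0. u r > 0) \<and>
     (\<forall>r>0. u differentiable (at r)) \<and> continuous_on {0<..} (deriv u) \<and>
     (\<forall>r>0. \<exists>w'. ((\<lambda>s. s ^ (n - k) * \<bar>deriv u s\<bar> ^ (k - 1) * deriv u s)
                      has_real_derivative w') (at r) \<and>
                 - (1 / real k) * Cnk n k * w' = r ^ (n - 1) * u r powr p)"

definition regular_sol :: "'n::finite itself \<Rightarrow> nat \<Rightarrow> real \<Rightarrow> real \<Rightarrow> (real \<Rightarrow> real) \<Rightarrow> bool" where
  "regular_sol _ k p \<rho> u \<longleftrightarrow>
     \<rho> > 0 \<and> is_sol CARD('n) k p u \<and> u 0 = \<rho> \<and>
     (u has_real_derivative 0) (at 0 within {0..}) \<and>
     Ck 2 (\<lambda>x::real^'n. u (norm x))"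

definition W_star :: "'n::finite itself \<Rightarrow> (real \<Rightarrow> real) set" where
  "W_star _ = {\<phi>. \<exists>\<psi> :: real^'n \<Rightarrow> real. smooth \<psi> \<and> (\<exists>M. \<forall>x. M < norm x \<longrightarrow> \<psi> x = 0) \<and>
       (\<forall>x y. norm x = norm y \<longrightarrow> \<psi> x = \<psi> y) \<and> (\<forall>x. x \<noteq> 0 \<longrightarrow> \<phi> (norm x) = \<psi> x)}"

definition test_fun :: "real \<Rightarrow> (real \<Rightarrow> real) \<Rightarrow> bool" where
  "test_fun R \<phi> \<longleftrightarrow> smooth \<phi> \<and> (\<exists>a b. R < a \<and> (\<forall>x. x \<notin> {a..b} \<longrightarrow> \<phi> x = 0))"

definition Q :: "nat \<Rightarrow> nat \<Rightarrow> real \<Rightarrow> (real \<Rightarrow> real) \<Rightarrow> (real \<Rightarrow> real) \<Rightarrow> real" where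
  "Q n k p u \<phi> =
     Cnk n k * (LINT r:{0<..}|lborel. r ^ (n - k) * \<bar>deriv u r\<bar> ^ (k - 1) * (deriv \<phi> r)\<^sup>2)
     - p * (LINT r:{0<..}|lborel. r ^ (n - 1) * u r powr (p - 1) * (\<phi> r)\<^sup>2)"

definition stable_on :: "'n::finite itself \<Rightarrow> nat \<Rightarrow> real \<Rightarrow> (real \<Rightarrow> real) \<Rightarrow> real \<Rightarrow> bool" where
  "stable_on T k p u R \<longleftrightarrow>
     (\<forall>\<phi>\<in>W_star T.
        set_integrable lborel {0<..}
          (\<lambda>r. (1 / real k) * Cnk CARD('n) k * r ^ (CARD('n) - k) * \<bar>deriv u r\<bar> ^ (k - 1)
                 * deriv u r * deriv \<phi> r - r ^ (CARD('n) - 1) * u r powr p * \<phi> r) \<and>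
        (LINT r:{0<..}|lborel. (1 / real k) * Cnk CARD('n) k * r ^ (CARD('n) - k) * \<bar>deriv u r\<bar> ^ (k - 1)
                 * deriv u r * deriv \<phi> r - r ^ (CARD('n) - 1) * u r powr p * \<phi> r) = 0) \<and>
     (\<forall>\<phi>. test_fun R \<phi> \<longrightarrow> Q CARD('n) k p u \<phi> \<ge> 0)"

definition p_so :: "nat \<Rightarrow> nat \<Rightarrow> real" where
  "p_so n k = (real n + 2) * real k / (real n - 2 * real k)"
definition p_se :: "nat \<Rightarrow> nat \<Rightarrow> real" where
  "p_se n k = real n * real k / (real n - 2 * real k)"
definition p_star :: "nat \<Rightarrow> nat \<Rightarrow> real" where
  "p_star n k = real k * (real n + 2 * real k) / (real n - 2 * real k)"
definition p_jl :: "nat \<Rightarrow> nat \<Rightarrow> ereal" where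
  "p_jl n k = (if n \<le> 2 * k + 8 then \<infinity> else
     ereal ((real k * ((real n)\<^sup>2 - 2 * (real k + 3) * real n + 4 * real k)
             + 4 * real k * sqrt (2 * (real k + 1) * real n - 4 * real k))
            / ((real n - 2 * real k) * (real n - 2 * real k - 8))))"

definition A_const :: "nat \<Rightarrow> nat \<Rightarrow> real \<Rightarrow> real" where
  "A_const n k p = ((1 / real k) * Cnk n k) powr (1 / (p - real k))
     * (2 * real k / (p - real k)) powr (real k / (p - real k))
     * (real n - 2 * p * real k / (p - real k)) powr (1 / (p - real k))"

definition u_s :: "nat \<Rightarrow> nat \<Rightarrow> real \<Rightarrow> real \<Rightarrow> real" where
  "u_s n k p r = A_const n k p * r powr (- (2 * real k / (p - real k)))"

end

theory Submission
  imports Defs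
begin

text \<open>The scaling generator \<open>v = r u' + \<alpha> u\<close> with \<open>\<alpha> = 2k/(p - k)\<close> solves the linearised equation, so by
  Picone's identity a solution is stable on every half line on which \<open>v\<close> has no zero. Since
  \<open>v = u (\<alpha> - X)\<close> with \<open>X = -r u'/u\<close>, only the eventual position of \<open>X\<close> relative to \<open>\<alpha>\<close> matters. With
  \<open>w = r^(n-k) |u'|^(k-1) u'\<close> and \<open>Z = r w'/w\<close> the equation becomes the autonomous quadratic system
  \<open>r X' = X (X + Z/k - \<beta>)\<close>, \<open>r Z' = Z (n - p X - Z)\<close>, \<open>\<beta> = (n - 2k)/k\<close>, and regular solutions leave
  \<open>(0, n)\<close>. For \<open>p = p_so\<close> they follow an invariant line along which \<open>X\<close> increases; for
  \<open>p \<ge> p_jl\<close> the equilibrium with \<open>X = \<alpha>\<close> is a node and one of its eigendirections bars the trajectory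
  from crossing \<open>X = \<alpha>\<close>; for the fast decaying solutions of (ii), \<open>X\<close> tends to \<open>\<beta> > \<alpha>\<close>.\<close>

section \<open>Behaviour at the origin\<close>

text \<open>The assumption \<open>origin\<close> excludes the singular profile \<open>r powr - \<beta>\<close> that a nonzero limit of \<open>w\<close> at
  the origin would force.\<close>

locale hessian_solution =
  fixes n k :: nat and p :: real and u :: "real \<Rightarrow> real"
  assumes k_gt_1: "1 < k" and n_gt: "2 * k < n"
    and sol: "is_sol n k p u"
    and origin: "((\<lambda>r. u r * r powr ((real n - 2 * real k) / real k)) \<longlongrightarrow> 0) (at_right 0)"
begin

definition c :: real where "c = Cnk n k"
text \<open>For \<open>r powr - \<beta>\<close> the flux \<open>w\<close> is constant: this power is
  the singular radial solution of the equation with zero right-hand side.\<close>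

definition \<beta> :: real where "\<beta> = (real n - 2 * real k) / real k"
definition w :: "real \<Rightarrow> real" where "w r = r ^ (n - k) * \<bar>deriv u r\<bar> ^ (k - 1) * deriv u r"

lemma c_pos: "c > 0"
  using n_gt by (simp add: c_def Cnk_def)

lemma beta_pos: "\<beta> > 0"
proof -
  have "real (2 * k) < real n" using n_gt by (simp only: of_nat_less_iff)
  then show ?thesis using k_gt_1 by (simp add: \<beta>_def)
qed

lemma u_pos: "r > 0 \<Longrightarrow> u r > 0"
  using sol by (simp add: is_sol_def)

lemma u_deriv: "r > 0 \<Longrightarrow> (u has_real_derivative deriv u r) (at r)"
  using sol by (simp add: is_sol_def DERIV_deriv_iff_real_differentiable)

lemma continuous_u: "continuous_on {0<..} u"
  by (meson DERIV_isCont continuous_at_imp_continuous_on greaterThan_iff u_deriv)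

lemma w_deriv:
  assumes "r > 0"
  shows "(w has_real_derivative - (real k / c) * (r ^ (n - 1) * u r powr p)) (at r)"
proof -
  obtain w' where w': "(w has_real_derivative w') (at r)"
    and e: "- (1 / real k) * c * w' = r ^ (n - 1) * u r powr p"
    using sol assms unfolding is_sol_def w_def[abs_def] c_def by blast
  have "w' = - (real k / c) * (r ^ (n - 1) * u r powr p)"
    unfolding e[symmetric] using c_pos k_gt_1 by simp
  with w' show ?thesis by simp
qed

lemma continuous_w: "continuous_on {0<..} w"
  by (meson DERIV_isCont continuous_at_imp_continuous_on greaterThan_iff w_deriv)

lemma w_strict_antimono:
  assumes "0 < r" "r < s"
  shows "w s < w r"
proof (rule DERIV_neg_imp_decreasing[where f = w, OF assms(2)])
  fix x assume "r \<le> x" "x \<le> s"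
  then have "x > 0" using assms(1) by simp
  then show "\<exists>y. (w has_real_derivative y) (at x) \<and> y < 0"
    using w_deriv[of x] u_pos[of x] c_pos k_gt_1
    by (intro exI[of _ "- (real k / c) * (x ^ (n - 1) * u x powr p)"]) auto
qed

text \<open>Since \<open>(n - k) / k = \<beta> + 1\<close>, a constant bound on \<open>w\<close>
  becomes a bound on \<open>deriv u\<close> by a multiple of \<open>r powr (- \<beta> - 1)\<close>,
  which integrates to a multiple of \<open>r powr - \<beta>\<close>.\<close>

lemma root_power:
  assumes "r > 0" "e > 0"
  shows "(e / r ^ (n - k)) powr (1 / real k) = e powr (1 / real k) * r powr (- \<beta> - 1)"
proof -
  have "(r ^ (n - k)) powr (1 / real k) = r powr (\<beta> + 1)"
    using assms n_gt k_gt_1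
    by (simp add: powr_realpow[symmetric] powr_powr \<beta>_def of_nat_diff field_simps)
  then show ?thesis using assms
    by (simp add: powr_divide) (simp add: powr_minus[symmetric] divide_inverse)
qed

lemma w_pos_imp:
  assumes "r > 0" "e > 0" "e \<le> w r"
  shows "e powr (1 / real k) * r powr (- \<beta> - 1) \<le> deriv u r"
proof -
  have pos: "deriv u r > 0"
  proof (rule ccontr)
    assume "\<not> ?thesis"
    then have "w r \<le> 0" using assms(1) by (simp add: w_def mult_nonneg_nonpos)
    with assms show False by simp
  qed
  have "w r = r ^ (n - k) * deriv u r ^ k"
    using pos k_gt_1 by (simp add: w_def power_eq_if[of _ k])
  then have "e / r ^ (n - k) \<le> deriv u r ^ k"
    using assms by (simp add: field_simps)
  then have "(e / r ^ (n - k)) powr (1 / real k) \<le> (deriv u r ^ k) powr (1 / real k)"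
    using assms by (intro powr_mono2) auto
  also have "\<dots> = deriv u r"
    using pos k_gt_1 by (simp add: powr_realpow[symmetric] powr_powr)
  finally show ?thesis using root_power assms by simp
qed

lemma w_neg_imp:
  assumes "r > 0" "w r < 0"
  shows "deriv u r < 0" "- w r = r ^ (n - k) * (- deriv u r) ^ k"
    "- deriv u r = (- w r / r ^ (n - k)) powr (1 / real k)"
proof -
  show neg: "deriv u r < 0"
  proof (rule ccontr)
    assume "\<not> ?thesis"
    then have "w r \<ge> 0" using assms(1) by (simp add: w_def)
    with assms show False by simp
  qed
  show eq: "- w r = r ^ (n - k) * (- deriv u r) ^ k"
    using neg k_gt_1 by (simp add: w_def power_eq_if[of _ k])
  have "- w r / r ^ (n - k) = (- deriv u r) ^ k"
    using eq assms(1) by (simp add: field_simps)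
  then show "- deriv u r = (- w r / r ^ (n - k)) powr (1 / real k)"
    using neg k_gt_1 by (simp add: powr_realpow[symmetric] powr_powr)
qed

lemma powr_beta_tendsto_0: "((\<lambda>r. r powr \<beta>) \<longlongrightarrow> 0) (at_right 0)"
  using beta_pos by (intro tendsto_eq_intros) (auto simp: eventually_at_filter)

text \<open>Were \<open>w\<close> nonnegative somewhere, it would exceed a positive constant near
  the origin, and integrating the resulting lower bound on \<open>deriv u\<close> would push the
  limit of \<open>u r * r powr \<beta>\<close> below zero, against \<open>origin\<close>.\<close>

lemma w_neg:
  assumes "s > 0"
  shows "w s < 0"
proof (rule ccontr)
  assume "\<not> w s < 0"
  \<comment> \<open>Halving \<open>s\<close> turns \<open>w s \<ge> 0\<close> into the strict
    \<open>w t > 0\<close>.\<close>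
  define t where "t = s / 2"
  define e where "e = w t"
  have t: "t > 0" and e: "e > 0"
    using assms w_strict_antimono[of t s] \<open>\<not> w s < 0\<close> by (auto simp: t_def e_def)
  define b where "b = e powr (1 / real k) / \<beta>"
  have b: "b > 0" using e beta_pos by (simp add: b_def)
  define h where "h r = u r + b * r powr (- \<beta>)" for r
  have hd: "(h has_real_derivative deriv u r - e powr (1 / real k) * r powr (- \<beta> - 1)) (at r)" if "r > 0" for r
    unfolding h_def[abs_def] b_def
    using that beta_pos by (auto intro!: derivative_eq_intros u_deriv)
  have mono: "h r \<le> h t" if "0 < r" "r < t" for r
  proof (rule DERIV_nonneg_imp_nondecreasing[where f = h])
    fix x assume x: "r \<le> x" "x \<le> t"
    then have "e \<le> w x" using that w_strict_antimono[of x t] by (cases "x = t") (auto simp: e_def)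
    then show "\<exists>y. (h has_real_derivative y) (at x) \<and> 0 \<le> y"
      using hd[of x] w_pos_imp[of x e] x that e by fastforce
  qed (use that in auto)
  have "eventually (\<lambda>r. u r * r powr \<beta> + b \<le> h t * r powr \<beta>) (at_right 0)"
    using eventually_at_right_less[of 0] order_tendstoD(2)[OF tendsto_ident_at t]
  proof eventually_elim
    case (elim r)
    then have "h r * r powr \<beta> \<le> h t * r powr \<beta>"
      using mono by (intro mult_right_mono) auto
    then show ?case using elim by (simp add: h_def ring_distribs powr_add[symmetric] mult.assoc)
  qed
  then have "0 + b \<le> h t * 0"
    using origin powr_beta_tendsto_0 unfolding \<beta>_def[symmetric]
    by (intro tendsto_le[OF _ tendsto_mult[OF tendsto_const] tendsto_add[OF _ tendsto_const]]) auto
  with b show False by simp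
qed

text \<open>By monotonicity \<open>w\<close> has a limit at the origin, at most 0 by
  \<open>w_neg\<close>. If \<open>w\<close> stayed below \<open>- e\<close>, then \<open>u\<close>
  would dominate \<open>b * r powr - \<beta>\<close> up to a constant, again contradicting
  \<open>origin\<close>.\<close>

lemma w_tendsto_0: "(w \<longlongrightarrow> 0) (at_right 0)"
proof -
  have ex: "\<exists>s>0. w s > - e" if e: "e > 0" for e
  proof (rule ccontr)
    assume contra: "\<not> ?thesis"
    define b where "b = e powr (1 / real k) / \<beta>"
    have b: "b > 0" using e beta_pos by (simp add: b_def)
    define h where "h r = u r - b * r powr (- \<beta>)" for r
    have hd: "(h has_real_derivative deriv u r + e powr (1 / real k) * r powr (- \<beta> - 1)) (at r)" if "r > 0" for r
      unfolding h_def[abs_def] b_def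
      using that beta_pos by (auto intro!: derivative_eq_intros u_deriv)
    have mono: "h r \<ge> h 1" if "0 < r" "r < 1" for r
    proof (rule DERIV_nonpos_imp_nonincreasing[where f = h])
      fix x assume x: "r \<le> x" "x \<le> 1"
      with that have x0: "x > 0" by simp
      then have "e \<le> - w x" using contra by fastforce
      then have "(e / x ^ (n - k)) powr (1 / real k) \<le> (- w x / x ^ (n - k)) powr (1 / real k)"
        using x0 e by (intro powr_mono2 divide_right_mono) auto
      then have "deriv u x + e powr (1 / real k) * x powr (- \<beta> - 1) \<le> 0"
        using root_power[OF x0 e] w_neg_imp(3)[OF x0 w_neg[OF x0]] by simp
      then show "\<exists>y. (h has_real_derivative y) (at x) \<and> y \<le> 0"
        using hd[OF x0] by blast
    qed (use that in auto)
    have "eventually (\<lambda>r. u r * r powr \<beta> - b \<ge> h 1 * r powr \<beta>) (at_right 0)"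
      using eventually_at_right_less[of 0] order_tendstoD(2)[OF tendsto_ident_at zero_less_one]
    proof eventually_elim
      case (elim r)
      then have "h r * r powr \<beta> \<ge> h 1 * r powr \<beta>"
        using mono by (intro mult_right_mono) auto
      then show ?case using elim by (simp add: h_def ring_distribs left_diff_distrib powr_add[symmetric] mult.assoc)
    qed
    then have "h 1 * 0 \<le> 0 - b"
      using origin powr_beta_tendsto_0 unfolding \<beta>_def[symmetric]
      by (intro tendsto_le[OF _ tendsto_diff[OF _ tendsto_const] tendsto_mult[OF tendsto_const]]) auto
    with b show False by simp
  qed
  show ?thesis
  proof (rule order_tendstoI)
    fix a :: real assume "a < 0"
    then obtain s where s: "s > 0" "w s > a" using ex[of "- a"] by auto
    show "eventually (\<lambda>r. a < w r) (at_right 0)"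
      using eventually_at_right_less[of 0] order_tendstoD(2)[OF tendsto_ident_at s(1)]
      by eventually_elim (use s w_strict_antimono in \<open>fastforce\<close>)
  next
    fix a :: real assume "0 < a"
    show "eventually (\<lambda>r. w r < a) (at_right 0)"
      using eventually_at_right_less[of 0]
      by eventually_elim (use w_neg \<open>0 < a\<close> in \<open>fastforce\<close>)
  qed
qed

end

section \<open>Stability from the scaling generator\<close>

lemma smooth_real_deriv:
  fixes \<phi> :: "real \<Rightarrow> real"
  assumes "smooth \<phi>"
  shows "(\<phi> has_real_derivative deriv \<phi> x) (at x)" "continuous_on UNIV (deriv \<phi>)"
proof -
  have C1: "Ck (Suc 0) \<phi>" using assms unfolding smooth_def by blast
  then have d: "(\<phi> has_real_derivative deriv \<phi> x) (at x)" for x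
    by (simp add: DERIV_deriv_iff_real_differentiable)
  then show "(\<phi> has_real_derivative deriv \<phi> x) (at x)" .
  have "frechet_derivative \<phi> (at x) 1 = deriv \<phi> x" for x
    using frechet_derivative_at[OF d[of x, unfolded has_field_derivative_def]]
    by (metis mult.right_neutral)
  with C1 show "continuous_on UNIV (deriv \<phi>)" by simp
qed

lemma set_lebesgue_integral_compact_support:
  fixes f :: "real \<Rightarrow> real"
  assumes "0 < a" "continuous_on {a..b} f" "\<And>x. x \<notin> {a..b} \<Longrightarrow> f x = 0"
  shows "(LINT r:{0<..}|lborel. f r) = integral {a..b} f"
proof -
  have "(\<lambda>r. indicator {0<..} r *\<^sub>R f r) = (\<lambda>r. indicator {a..b} r *\<^sub>R f r)"
    using assms(1,3) by (fastforce simp: indicator_def)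
  then have "(LINT r:{0<..}|lborel. f r) = (LINT r:{a..b}|lborel. f r)"
    by (simp add: set_lebesgue_integral_def)
  also have "\<dots> = integral {a..b} f"
    by (intro set_borel_integral_eq_integral borel_integrable_atLeastAtMost' assms)
  finally show ?thesis .
qed

text \<open>The quotient \<open>a * v' * \<phi>\<^sup>2 / v\<close> has derivative
  \<open>a * (deriv \<phi>)\<^sup>2 - b * \<phi>\<^sup>2\<close> minus a nonnegative square term,
  and its boundary values vanish because \<phi> has compact support.\<close>

lemma picone_nonneg:
  fixes a b v v' \<phi> :: "real \<Rightarrow> real"
  assumes "R \<ge> 0"
    and v: "\<And>r. r > R \<Longrightarrow> (v has_real_derivative v' r) (at r)"
    and v0: "\<And>r. r > R \<Longrightarrow> v r \<noteq> 0"
    and av: "\<And>r. r > R \<Longrightarrow> ((\<lambda>r. a r * v' r) has_real_derivative - (b r * v r)) (at r)"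
    and a: "\<And>r. r > R \<Longrightarrow> a r \<ge> 0" "continuous_on {R<..} a"
    and b: "continuous_on {R<..} b"
    and \<phi>: "test_fun R \<phi>"
  shows "(LINT r:{0<..}|lborel. b r * (\<phi> r)\<^sup>2) \<le> (LINT r:{0<..}|lborel. a r * (deriv \<phi> r)\<^sup>2)"
proof -
  obtain l h where l: "R < l" and supp: "\<And>x. x \<notin> {l..h} \<Longrightarrow> \<phi> x = 0" and sm: "smooth \<phi>"
    using \<phi> unfolding test_fun_def by blast
  note d = smooth_real_deriv[OF sm]
  have supp': "deriv \<phi> x = 0" if "x \<notin> {l..h}" for x
  proof -
    have "open (- {l..h})" by (simp add: open_Compl)
    moreover have "\<And>y. y \<in> - {l..h} \<Longrightarrow> 0 = \<phi> y" using supp by auto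
    moreover have "x \<in> - {l..h}" using that by simp
    ultimately have "(\<phi> has_real_derivative 0) (at x)"
      using has_field_derivative_transform_within_open[OF DERIV_const] by blast
    then show ?thesis by (rule DERIV_imp_deriv)
  qed
  \<comment> \<open>\<open>l'\<close> lies strictly between \<open>R\<close> and the support, and
    \<open>h'\<close> beyond it; the maximum keeps \<open>l' < h'\<close> even when
    \<open>{l..h}\<close> is empty.\<close>
  define l' where "l' = (R + l) / 2"
  define h' where "h' = max l h + 1"
  have l': "R < l'" "l' < l" and h': "h < h'" "l' < h'"
    using l by (auto simp: l'_def h'_def)
  have sub: "{l'..h'} \<subseteq> {R<..}" using l' by auto
  have out: "x \<notin> {l..h}" if "x \<notin> {l'..h'}" for x using that l' h' by auto
  define F where "F r = a r * v' r * (\<phi> r)\<^sup>2 / v r" for r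
  define f where "f r = a r * (deriv \<phi> r)\<^sup>2 - b r * (\<phi> r)\<^sup>2 - a r * (deriv \<phi> r - \<phi> r * v' r / v r)\<^sup>2" for r
  have F': "(F has_real_derivative f r) (at r)" if "r > R" for r
    unfolding F_def[abs_def]
    by (rule derivative_eq_intros av v d(1) v0 that refl)+
      (use v0[OF that] in \<open>simp add: f_def field_simps power2_eq_square\<close>)
  have "(f has_integral F h' - F l') {l'..h'}"
    using l' h' sub
    by (intro fundamental_theorem_of_calculus)
       (auto simp: has_real_derivative_iff_has_vector_derivative[symmetric] intro!: has_field_derivative_at_within F')
  moreover have "F h' = 0" "F l' = 0" using supp l' h' by (auto simp: F_def)
  ultimately have f0: "(f has_integral 0) {l'..h'}" by simp
  have c\<phi>: "continuous_on S \<phi>" for S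
    by (meson DERIV_isCont continuous_at_imp_continuous_on d(1))
  have cA: "continuous_on {l'..h'} (\<lambda>r. a r * (deriv \<phi> r)\<^sup>2)"
    by (intro continuous_intros continuous_on_subset[OF a(2) sub] continuous_on_subset[OF d(2)]) auto
  have cB: "continuous_on {l'..h'} (\<lambda>r. b r * (\<phi> r)\<^sup>2)"
    by (intro continuous_intros continuous_on_subset[OF b sub] c\<phi>)
  have "((\<lambda>r. a r * (deriv \<phi> r)\<^sup>2 - b r * (\<phi> r)\<^sup>2) has_integral
      integral {l'..h'} (\<lambda>r. a r * (deriv \<phi> r)\<^sup>2) - integral {l'..h'} (\<lambda>r. b r * (\<phi> r)\<^sup>2)) {l'..h'}"
    by (intro has_integral_diff integrable_integral integrable_continuous_real cA cB)
  moreover have "f r \<le> a r * (deriv \<phi> r)\<^sup>2 - b r * (\<phi> r)\<^sup>2" if "r \<in> {l'..h'}" for r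
    using a(1)[of r] sub that by (auto simp: f_def)
  ultimately have "0 \<le> integral {l'..h'} (\<lambda>r. a r * (deriv \<phi> r)\<^sup>2) - integral {l'..h'} (\<lambda>r. b r * (\<phi> r)\<^sup>2)"
    by (rule has_integral_le[OF f0])
  moreover have "(LINT r:{0<..}|lborel. a r * (deriv \<phi> r)\<^sup>2) = integral {l'..h'} (\<lambda>r. a r * (deriv \<phi> r)\<^sup>2)"
    using l'(1) \<open>R \<ge> 0\<close> supp' out by (intro set_lebesgue_integral_compact_support cA) auto
  moreover have "(LINT r:{0<..}|lborel. b r * (\<phi> r)\<^sup>2) = integral {l'..h'} (\<lambda>r. b r * (\<phi> r)\<^sup>2)"
    using l'(1) \<open>R \<ge> 0\<close> supp out by (intro set_lebesgue_integral_compact_support cB) auto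
  ultimately show ?thesis by simp
qed

section \<open>Logarithmic derivatives as phase variables, and the sign of \<open>Q\<close>\<close>

context hessian_solution
begin

definition X :: "real \<Rightarrow> real" where "X r = - r * deriv u r / u r"
text \<open>This is \<open>r * deriv w r / w r\<close> with the derivative eliminated through the
  equation, so that \<open>Z\<close> is visibly differentiable.\<close>

definition Z :: "real \<Rightarrow> real" where "Z r = real k / c * r ^ n * u r powr p / (- w r)"

lemma deriv_u_neg: "r > 0 \<Longrightarrow> deriv u r < 0"
  using w_neg_imp(1) w_neg by blast

lemma X_pos: "r > 0 \<Longrightarrow> X r > 0"
  using deriv_u_neg[of r] u_pos[of r] by (simp add: X_def divide_neg_pos mult_pos_neg)

lemma Z_pos: "r > 0 \<Longrightarrow> Z r > 0"
  using w_neg[of r] u_pos[of r] c_pos k_gt_1 unfolding Z_def by (intro divide_pos_pos mult_pos_pos) auto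

lemma Z_w: "r > 0 \<Longrightarrow> Z r * w r = - (real k / c * r ^ n * u r powr p)"
  using w_neg[of r] by (simp add: Z_def)

lemma w_deriv':
  assumes "r > 0"
  shows "(w has_real_derivative Z r * w r / r) (at r)"
proof -
  have "r ^ n = r * r ^ (n - 1)" using n_gt by (simp add: power_eq_if)
  then have "Z r * w r / r = - (real k / c) * (r ^ (n - 1) * u r powr p)"
    using Z_w[OF assms] assms by simp
  then show ?thesis using w_deriv[OF assms] by simp
qed

text \<open>A solution is only assumed to be of class C^1, so the second derivative is obtained by
  solving the flux for \<open>deriv u\<close>: the \<open>k\<close>-th root of
  \<open>- w r / r ^ (n - k)\<close> is differentiable because \<open>w_neg\<close> makes its
  argument positive.\<close>

lemma deriv_u_deriv:
  assumes r: "r > 0"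
  shows "(deriv u has_real_derivative deriv u r * ((Z r - real (n - k)) / (real k * r))) (at r)"
proof -
  define f where "f s = - w s / s ^ (n - k)" for s
  have fpos: "f s > 0" if "s > 0" for s
    unfolding f_def using w_neg[OF that] that by (intro divide_pos_pos) auto
  have eq: "deriv u s = - (f s powr (1 / real k))" if "s > 0" for s
    using w_neg_imp(3)[OF that w_neg[OF that]] by (simp add: f_def)
  have pw: "r ^ (n - k) = r * r ^ (n - k - 1)" using n_gt by (simp add: power_eq_if)
  have "(f has_real_derivative
      ((- (Z r * w r / r)) * r ^ (n - k) - (- w r) * (real (n - k) * r ^ (n - k - 1)))
        / (r ^ (n - k) * r ^ (n - k))) (at r)"
    unfolding f_def[abs_def] using r
    by (auto intro!: derivative_eq_intros w_deriv' simp: minus_divide_left simp del: divide_minus_left)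
  also have "((- (Z r * w r / r)) * r ^ (n - k) - (- w r) * (real (n - k) * r ^ (n - k - 1)))
        / (r ^ (n - k) * r ^ (n - k)) = f r * ((Z r - real (n - k)) / r)"
    unfolding f_def pw using r by (simp add: field_simps)
  finally have f': "(f has_real_derivative f r * ((Z r - real (n - k)) / r)) (at r)" .
  have "((\<lambda>s. f s powr (1 / real k)) has_real_derivative
      1 / real k * f r powr (1 / real k - 1) * (f r * ((Z r - real (n - k)) / r))) (at r)"
    using DERIV_fun_powr[OF f' fpos[OF r], of "1 / real k"] by simp
  then have "((\<lambda>s. - (f s powr (1 / real k))) has_real_derivative
      - (1 / real k * f r powr (1 / real k - 1) * (f r * ((Z r - real (n - k)) / r)))) (at r)"
    by (rule DERIV_minus)
  moreover have "f r powr (1 / real k - 1) * f r = f r powr (1 / real k)"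
    using fpos[OF r] by (simp add: powr_diff)
  then have "- (1 / real k * f r powr (1 / real k - 1) * (f r * ((Z r - real (n - k)) / r)))
     = deriv u r * ((Z r - real (n - k)) / (real k * r))"
    unfolding eq[OF r] by (simp add: mult.assoc[symmetric])
  ultimately have "((\<lambda>s. - (f s powr (1 / real k))) has_real_derivative
      deriv u r * ((Z r - real (n - k)) / (real k * r))) (at r)" by simp
  then show ?thesis
    by (rule has_field_derivative_transform_within_open[where S = "{0<..}"]) (use r eq in auto)
qed

lemma X_deriv:
  assumes r: "r > 0"
  shows "(X has_real_derivative X r / r * (X r + Z r / real k - \<beta>)) (at r)"
  unfolding X_def[abs_def]
  by (rule derivative_eq_intros deriv_u_deriv u_deriv refl r)+
     (use u_pos[OF r] r n_gt k_gt_1 in \<open>simp_all add: X_def \<beta>_def of_nat_diff field_simps power2_eq_square\<close>)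

lemma Z_deriv:
  assumes r: "r > 0"
  shows "(Z has_real_derivative Z r / r * (real n - p * X r - Z r)) (at r)"
proof -
  have pw: "r ^ n = r * r ^ (n - 1)" using n_gt by (simp add: power_eq_if)
  have up: "u r powr (p - 1) = u r powr p / u r" using u_pos[OF r] by (simp add: powr_diff)
  have Zr: "Z r = real k / c * r ^ n * u r powr p / (- w r)" by (fact Z_def)
  define N where "N s = real k / c * s ^ n * u s powr p" for s
  have N': "(N has_real_derivative N r / r * (real n - p * X r)) (at r)"
    unfolding N_def[abs_def]
    by (rule derivative_eq_intros u_deriv DERIV_fun_powr refl r u_pos)+
       (use u_pos[OF r] r c_pos in \<open>simp_all add: X_def pw up field_simps\<close>)
  have "((\<lambda>s. N s / - w s) has_real_derivative
      (N r / r * (real n - p * X r) * (- w r) - N r * (- (Z r * w r / r))) / ((- w r) * (- w r))) (at r)"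
    using w_neg[OF r] by (auto intro!: derivative_eq_intros N' w_deriv'[OF r] simp: minus_divide_left simp del: divide_minus_left)
  also have "(N r / r * (real n - p * X r) * (- w r) - N r * (- (Z r * w r / r))) / ((- w r) * (- w r))
     = N r / (- w r) / r * (real n - p * X r - Z r)"
    using w_neg[OF r] r by (simp add: field_simps)
  finally show ?thesis by (simp add: Z_def[abs_def] N_def)
qed

text \<open>The scaling exponent: for \<open>p > k\<close> and \<open>t > 0\<close>,
  \<open>t powr \<alpha> * u (t * r)\<close> again solves the equation, and its derivative in
  \<open>t\<close> at 1 is the \<open>v\<close> of the next lemma.\<close>

definition \<alpha> :: real where "\<alpha> = 2 * real k / (p - real k)"

lemma Q_nonneg:
  assumes p: "p > real k" and R: "R \<ge> 0" and ne: "\<And>r. r > R \<Longrightarrow> X r \<noteq> \<alpha>"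
    and \<phi>: "test_fun R \<phi>"
  shows "Q n k p u \<phi> \<ge> 0"
proof -
  define v where "v r = \<alpha> * u r + r * deriv u r" for r
  define v' where "v' r = deriv u r * (1 + \<alpha> + (Z r - real (n - k)) / real k)" for r
  define a where "a r = c * (r ^ (n - k) * \<bar>deriv u r\<bar> ^ (k - 1))" for r
  define b where "b r = p * (r ^ (n - 1) * u r powr (p - 1))" for r
  have v_eq: "v r = u r * (\<alpha> - X r)" if "r > 0" for r
    using u_pos[OF that] by (simp add: v_def X_def field_simps)
  have dv: "(v has_real_derivative v' r) (at r)" if r: "r > R" for r
    unfolding v_def[abs_def]
    by (rule derivative_eq_intros deriv_u_deriv u_deriv refl order.strict_trans1[OF R r])+
       (use r R k_gt_1 in \<open>simp_all add: v'_def field_simps\<close>)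
  \<comment> \<open>\<open>Z_w\<close> removes \<open>Z\<close>, leaving an expression in
    \<open>w\<close> and \<open>u\<close> that \<open>w_deriv\<close> can differentiate.\<close>
  have av_eq: "a r * v' r = c * w r * (1 + \<alpha> - real (n - k) / real k) - r ^ n * u r powr p"
    if r: "r > 0" for r
  proof -
    have "a r * v' r = c * w r * (1 + \<alpha> - real (n - k) / real k) + c * (Z r * w r) / real k"
      by (simp add: a_def v'_def w_def diff_divide_distrib algebra_simps)
    then show ?thesis using c_pos k_gt_1 by (simp add: Z_w[OF r])
  qed
  have dav: "((\<lambda>r. a r * v' r) has_real_derivative - (b r * v r)) (at r)" if "r > R" for r
  proof -
    have r: "r > 0" using that R by simp
    have pw: "r ^ n = r * r ^ (n - 1)" using n_gt by (simp add: power_eq_if)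
    have up: "u r powr p = u r * u r powr (p - 1)" using u_pos[OF r] by (simp add: powr_diff)
    define y where "y = r ^ (n - 1) * u r powr (p - 1)"
    have "((\<lambda>r. c * w r * (1 + \<alpha> - real (n - k) / real k) - r ^ n * u r powr p) has_real_derivative
        c * (- (real k / c) * (r ^ (n - 1) * u r powr p)) * (1 + \<alpha> - real (n - k) / real k)
        - (real n * r ^ (n - 1) * u r powr p + r ^ n * (p * u r powr (p - 1) * deriv u r))) (at r)"
      using u_pos[OF r] by (auto intro!: derivative_eq_intros w_deriv r u_deriv DERIV_fun_powr)
    also have "c * (- (real k / c) * (r ^ (n - 1) * u r powr p)) * (1 + \<alpha> - real (n - k) / real k)
        - (real n * r ^ (n - 1) * u r powr p + r ^ n * (p * u r powr (p - 1) * deriv u r))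
       = - (y * u r * (real k * (1 + \<alpha> - real (n - k) / real k) + real n)) - p * y * r * deriv u r"
      unfolding pw up y_def using c_pos by (simp add: algebra_simps)
    \<comment> \<open>The defining property \<open>\<alpha> * (p - k) = 2 * k\<close> enters here;
      it is what makes \<open>v\<close> solve the linearised equation.\<close>
    also have "real k * (1 + \<alpha> - real (n - k) / real k) + real n = p * \<alpha>"
      using p k_gt_1 n_gt by (simp add: \<alpha>_def of_nat_diff field_simps)
    also have "- (y * u r * (p * \<alpha>)) - p * y * r * deriv u r = - (b r * v r)"
      by (simp add: b_def v_def y_def algebra_simps)
    finally show ?thesis
      by (rule has_field_derivative_transform_within_open[where S = "{0<..}"]) (use r av_eq in auto)
  qed
  have c0: "continuous_on {R<..} (deriv u)"
    using sol R unfolding is_sol_def by (blast intro: continuous_on_subset order.strict_trans1)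
  have cu: "continuous_on {R<..} u"
    using continuous_u by (rule continuous_on_subset) (use R in auto)
  have "(LINT r:{0<..}|lborel. b r * (\<phi> r)\<^sup>2) \<le> (LINT r:{0<..}|lborel. a r * (deriv \<phi> r)\<^sup>2)"
  proof (rule picone_nonneg[OF R dv _ dav _ _ _ \<phi>])
    show "v r \<noteq> 0" if "r > R" for r
      using v_eq[of r] ne[OF that] u_pos[of r] that R by auto
    show "a r \<ge> 0" if "r > R" for r
      using that R c_pos by (simp add: a_def)
    show "continuous_on {R<..} a" unfolding a_def
      by (intro continuous_intros c0)
    show "continuous_on {R<..} b" unfolding b_def
    proof (intro continuous_intros cu ballI)
      show "u r \<noteq> 0" if "r \<in> {R<..}" for r using u_pos[of r] that R by auto
    qed
  qed
  then show ?thesis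
    by (simp add: Q_def a_def b_def c_def mult.assoc)
qed

end

section \<open>The weak equation\<close>

text \<open>\<open>W_star\<close> ties \<open>\<phi>\<close> to \<open>\<psi>\<close> only at
  positive radii. Restricting \<open>\<psi>\<close> to a ray gives a function \<open>g\<close>
  differentiable across 0, whose bounds on the compact \<open>{0..M}\<close> control
  \<open>\<phi>\<close> and its derivative near the origin.\<close>

lemma W_star_deriv_bounds:
  assumes "\<phi> \<in> W_star TYPE('n::finite)"
  obtains D B M where "\<And>r. r > 0 \<Longrightarrow> (\<phi> has_real_derivative D r) (at r)"
    "continuous_on {0<..} D" "M > 0" "\<And>r. r > M \<Longrightarrow> \<phi> r = 0" "\<And>r. r > M \<Longrightarrow> D r = 0"
    "\<And>r. r > 0 \<Longrightarrow> \<bar>\<phi> r\<bar> \<le> B" "\<And>r. r > 0 \<Longrightarrow> \<bar>D r\<bar> \<le> B"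
proof -
  obtain \<psi> :: "real^'n \<Rightarrow> real" and M0 where sm: "smooth \<psi>"
    and M0: "\<And>x. M0 < norm x \<Longrightarrow> \<psi> x = 0" and eq: "\<And>x. x \<noteq> 0 \<Longrightarrow> \<phi> (norm x) = \<psi> x"
    using assms unfolding W_star_def by blast
  \<comment> \<open>The direction is a coordinate vector because \<open>Ck\<close> speaks of
    derivatives along \<open>Basis\<close>.\<close>
  define e :: "real^'n" where "e = axis undefined 1"
  have e: "norm e = 1" "e \<in> Basis" "e \<noteq> 0" by (auto simp: e_def norm_axis_1)
  define g where "g r = \<psi> (r *\<^sub>R e)" for r
  define D where "D r = frechet_derivative \<psi> (at (r *\<^sub>R e)) e" for r
  define M where "M = max M0 1"
  have C1: "Ck (Suc 0) \<psi>" using sm unfolding smooth_def by blast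
  have gD: "(g has_real_derivative D r) (at r)" for r
  proof -
    have d: "(\<psi> has_derivative frechet_derivative \<psi> (at (r *\<^sub>R e))) (at (r *\<^sub>R e))"
      using C1 by (simp add: frechet_derivative_works)
    have "((\<lambda>r. r *\<^sub>R e) has_derivative (\<lambda>h. h *\<^sub>R e)) (at r)"
      by (auto intro!: derivative_eq_intros)
    from diff_chain_at[OF this d]
    have "(g has_derivative (\<lambda>h. frechet_derivative \<psi> (at (r *\<^sub>R e)) (h *\<^sub>R e))) (at r)"
      by (simp add: g_def[abs_def] comp_def)
    moreover have "frechet_derivative \<psi> (at (r *\<^sub>R e)) (h *\<^sub>R e) = D r * h" for h
      using linear_frechet_derivative[of \<psi> "at (r *\<^sub>R e)"] C1 by (simp add: linear_scale D_def)
    ultimately show ?thesis by (simp add: has_field_derivative_def)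
  qed
  have cD: "continuous_on S D" for S
  proof -
    have "continuous_on UNIV (\<lambda>x. frechet_derivative \<psi> (at x) e)" using C1 e(2) by simp
    then show ?thesis unfolding D_def
      by (rule continuous_on_compose2) (auto intro!: continuous_intros)
  qed
  have cg: "continuous_on S g" for S
    by (meson DERIV_isCont continuous_at_imp_continuous_on gD)
  have g\<phi>: "\<phi> r = g r" if "r > 0" for r
    using eq[of "r *\<^sub>R e"] that e by (auto simp: g_def)
  have \<phi>D: "(\<phi> has_real_derivative D r) (at r)" if "r > 0" for r
    using gD[of r]
    by (rule has_field_derivative_transform_within_open[where S = "{0<..}"]) (use that g\<phi> in auto)
  have g0: "g r = 0" if "r > M" for r
    using M0[of "r *\<^sub>R e"] that e by (auto simp: g_def M_def)
  have D0: "D r = 0" if "r > M" for r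
  proof -
    have "(g has_real_derivative 0) (at r)"
      by (rule has_field_derivative_transform_within_open[OF DERIV_const[of 0], where S = "{M<..}"])
         (use that g0 in auto)
    then show ?thesis using gD DERIV_unique by blast
  qed
  obtain B1 where B1: "\<And>r. r \<in> {0..M} \<Longrightarrow> \<bar>g r\<bar> \<le> B1"
    using compact_imp_bounded[OF compact_continuous_image[OF cg compact_Icc, of 0 M]]
    unfolding bounded_iff by (metis imageI real_norm_def)
  obtain B2 where B2: "\<And>r. r \<in> {0..M} \<Longrightarrow> \<bar>D r\<bar> \<le> B2"
    using compact_imp_bounded[OF compact_continuous_image[OF cD compact_Icc, of 0 M]]
    unfolding bounded_iff by (metis imageI real_norm_def)
  have M1: "M > 0" by (simp add: M_def)
  have B0: "0 \<le> B1" "0 \<le> B2" using B1[of 0] B2[of 0] M1 by auto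
  show ?thesis
  proof
    show "\<bar>\<phi> r\<bar> \<le> max B1 B2" if "r > 0" for r
      using B1[of r] g0[of r] g\<phi>[OF that] B0 that by (cases "r \<le> M") (auto simp: le_max_iff_disj)
    show "\<bar>D r\<bar> \<le> max B1 B2" if "r > 0" for r
      using B2[of r] D0[of r] B0 that by (cases "r \<le> M") (auto simp: le_max_iff_disj)
  qed (use \<phi>D cD M1 g0 g\<phi> D0 in auto)
qed

context hessian_solution
begin

text \<open>The integrand is the derivative of \<open>c / k * w * \<phi>\<close>, whose boundary
  values vanish: at the origin because \<open>w\<close> tends to 0 while \<open>\<phi>\<close> is
  bounded, and beyond the support because \<open>\<phi>\<close> is zero.\<close>

lemma weak_equation:
  assumes \<phi>: "\<phi> \<in> W_star TYPE('n::finite)"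
  defines "f \<equiv> \<lambda>r. (1 / real k) * c * r ^ (n - k) * \<bar>deriv u r\<bar> ^ (k - 1) * deriv u r * deriv \<phi> r
    - r ^ (n - 1) * u r powr p * \<phi> r"
  shows "set_integrable lborel {0<..} f \<and> (LINT r:{0<..}|lborel. f r) = 0"
proof -
  obtain D B M where D: "\<And>r. r > 0 \<Longrightarrow> (\<phi> has_real_derivative D r) (at r)"
    and cD: "continuous_on {0<..} D" and M: "M > 0" and \<phi>0: "\<And>r. r > M \<Longrightarrow> \<phi> r = 0"
    and D0: "\<And>r. r > M \<Longrightarrow> D r = 0"
    and B: "\<And>r. r > 0 \<Longrightarrow> \<bar>\<phi> r\<bar> \<le> B" and B': "\<And>r. r > 0 \<Longrightarrow> \<bar>D r\<bar> \<le> B"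
    by (rule W_star_deriv_bounds[OF \<phi>]) (rule that)
  define h where "h = M + 1"
  have h: "h > 0" "h > M" using M by (auto simp: h_def)
  have B0: "B \<ge> 0" using B[of 1] by simp
  have f_eq: "f r = c / real k * w r * D r - r ^ (n - 1) * u r powr p * \<phi> r" if "r > 0" for r
    using DERIV_imp_deriv[OF D[OF that]] by (simp add: f_def w_def mult.assoc)
  have f_out: "f r = 0" if "r \<ge> h" for r
    using f_eq[of r] D0[of r] \<phi>0[of r] that h by simp
  have c\<phi>: "continuous_on {0<..} \<phi>"
    by (meson DERIV_isCont continuous_at_imp_continuous_on greaterThan_iff D)
  have cg: "continuous_on {0<..} (\<lambda>r. r ^ (n - 1) * u r powr p)"
    using u_pos by (intro continuous_intros continuous_u) fastforce
  have cf: "continuous_on {0<..} f"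
  proof (rule continuous_on_eq)
    show "continuous_on {0<..} (\<lambda>r. c / real k * w r * D r - r ^ (n - 1) * u r powr p * \<phi> r)"
      by (intro continuous_intros cg c\<phi> cD continuous_w)
  qed (simp add: f_eq)
  define F where "F r = c / real k * w r" for r
  have F: "(F has_real_derivative - (r ^ (n - 1) * u r powr p)) (at r)" if "r > 0" for r
    unfolding F_def[abs_def] using DERIV_cmult[OF w_deriv[OF that], of "c / real k"] c_pos k_gt_1
    by simp
  have F0: "(F \<longlongrightarrow> 0) (at_right 0)"
    unfolding F_def[abs_def] by (rule tendsto_mult_right_zero[OF w_tendsto_0])
  have isF: "(F \<longlongrightarrow> F h) (at_left h)" 
    using DERIV_isCont[OF F[OF h(1)]] by (simp add: isCont_def filterlim_at_split)
  have ei: "einterval (ereal 0) (ereal h) = {0<..<h}"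
    by (auto simp: einterval_def)
  \<comment> \<open>The solution may be unbounded at the origin. The integrand is nonnegative with
    antiderivative \<open>- F\<close>, and the finite limit of \<open>F\<close> at 0 yields
    integrability.\<close>
  have int_g: "set_integrable lborel {0<..<h} (\<lambda>r. r ^ (n - 1) * u r powr p)"
    unfolding ei[symmetric]
  proof (rule interval_integral_FTC_nonneg(1)[where F = "\<lambda>r. - F r" and A = "- 0" and B = "- F h"])
    show "(((\<lambda>r. - F r) \<circ> real_of_ereal) \<longlongrightarrow> - 0) (at_right (ereal 0))"
      using tendsto_minus[OF F0] by (simp add: ereal_tendsto_simps)
    show "(((\<lambda>r. - F r) \<circ> real_of_ereal) \<longlongrightarrow> - F h) (at_left (ereal h))"
      using tendsto_minus[OF isF] by (simp add: ereal_tendsto_simps)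
    show "isCont (\<lambda>r. r ^ (n - 1) * u r powr p) x" if "ereal 0 < ereal x" for x
      using cg that by (simp add: continuous_on_eq_continuous_at)
  qed (use h F in \<open>auto intro!: derivative_eq_intros\<close>)
  have int_c: "set_integrable lborel {0<..<h} (\<lambda>r. C)" for C :: real
    using h(1) by (auto simp: set_integrable_def integrable_indicator_iff)
  have "set_integrable lborel {0<..<h} (\<lambda>r. c / real k * \<bar>w h\<bar> * B + r ^ (n - 1) * u r powr p * B)"
    by (intro set_integral_add set_integrable_mult_left int_g int_c)
  then have int_f: "set_integrable lborel {0<..<h} f"
  proof (rule set_integrable_bound)
    show "set_borel_measurable lborel {0<..<h} f"
      unfolding set_borel_measurable_def
      using borel_measurable_continuous_on_indicator[OF _ continuous_on_subset[OF cf], of "{0<..<h}"]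
      by (simp add: greaterThanLessThan_def)
    have "\<bar>f r\<bar> \<le> c / real k * \<bar>w h\<bar> * B + r ^ (n - 1) * u r powr p * B" if r: "0 < r" "r < h" for r
    proof -
      have "\<bar>w r\<bar> \<le> \<bar>w h\<bar>" using w_strict_antimono[OF r] w_neg[OF r(1)] by simp
      then have "c / real k * \<bar>w r\<bar> * \<bar>D r\<bar> \<le> c / real k * \<bar>w h\<bar> * B"
        using c_pos B' r(1) by (intro mult_mono) auto
      moreover have "r ^ (n - 1) * u r powr p * \<bar>\<phi> r\<bar> \<le> r ^ (n - 1) * u r powr p * B"
        using B r(1) by (intro mult_left_mono) auto
      moreover have "\<bar>f r\<bar> \<le> c / real k * \<bar>w r\<bar> * \<bar>D r\<bar> + r ^ (n - 1) * u r powr p * \<bar>\<phi> r\<bar>"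
        unfolding f_eq[OF r(1)] using c_pos r(1)
        by (intro order.trans[OF abs_triangle_ineq4]) (simp add: abs_mult)
      ultimately show ?thesis by simp
    qed
    then show "AE x in lborel. x \<in> {0<..<h} \<longrightarrow>
        norm (f x) \<le> norm (c / real k * \<bar>w h\<bar> * B + x ^ (n - 1) * u x powr p * B)"
      by (intro AE_I2) (fastforce intro: order.trans abs_ge_self)
  qed
  define G where "G r = F r * \<phi> r" for r
  have G: "(G has_real_derivative f r) (at r)" if "r > 0" for r
    unfolding G_def[abs_def]
    by (rule derivative_eq_intros F D that refl)+ (simp add: f_eq[OF that] F_def)
  have "(LBINT r=ereal 0..ereal h. f r) = 0 - 0"
  proof (rule interval_integral_FTC_integrable[where F = G])
    have "(G \<longlongrightarrow> 0) (at_right 0)"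
    proof (rule Lim_null_comparison)
      show "eventually (\<lambda>r. norm (G r) \<le> \<bar>F r\<bar> * B) (at_right 0)"
        using eventually_at_right_less[of 0]
        by eventually_elim (use B in \<open>auto simp: G_def abs_mult intro!: mult_left_mono\<close>)
      show "((\<lambda>r. \<bar>F r\<bar> * B) \<longlongrightarrow> 0) (at_right 0)"
        using tendsto_mult[OF tendsto_rabs[OF F0] tendsto_const] by simp
    qed
    then show "((G \<circ> real_of_ereal) \<longlongrightarrow> 0) (at_right (ereal 0))"
      by (simp add: ereal_tendsto_simps)
    have "(G \<longlongrightarrow> G h) (at_left h)" 
      using DERIV_isCont[OF G[OF h(1)]] by (simp add: isCont_def filterlim_at_split)
    then show "((G \<circ> real_of_ereal) \<longlongrightarrow> 0) (at_left (ereal h))"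
      using \<phi>0[OF h(2)] by (simp add: ereal_tendsto_simps G_def)
    show "isCont f x" if "ereal 0 < ereal x" for x
      using cf that by (simp add: continuous_on_eq_continuous_at)
  qed (use h G int_f ei in \<open>auto simp: has_real_derivative_iff_has_vector_derivative[symmetric]\<close>)
  then have int_0: "(LINT r:{0<..<h}|lborel. f r) = 0"
    using h ei by (simp add: interval_lebesgue_integral_def)
  have "(\<lambda>r. indicator {0<..} r *\<^sub>R f r) = (\<lambda>r. indicator {0<..<h} r *\<^sub>R f r)"
    by (rule ext) (use f_out in \<open>auto simp: indicator_def not_less\<close>)
  then show ?thesis
    using int_f int_0 by (simp only: set_integrable_def set_lebesgue_integral_def simp_thms)
qed

lemma stable_onI:
  assumes "CARD('n::finite) = n" "p > real k" "R \<ge> 0" "\<And>r. r > R \<Longrightarrow> X r \<noteq> \<alpha>"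
  shows "stable_on TYPE('n) k p u R"
  using Q_nonneg[OF assms(2-4)] weak_equation[where 'n = 'n]
  unfolding stable_on_def assms(1) c_def by blast

end

section \<open>The phase plane\<close>

text \<open>At the infimum \<open>T\<close> of the points with \<open>m x \<le> 0\<close>, the
  function is positive before \<open>T\<close> but not at \<open>T\<close>, which
  \<open>step\<close> rules out. It serves invariant regions whose estimates hold only inside the
  region.\<close>

lemma continuous_first_exit:
  fixes m :: "real \<Rightarrow> real"
  assumes "a \<le> b" "continuous_on {a..b} m" "m a > 0"
    and step: "\<And>T. a < T \<Longrightarrow> T \<le> b \<Longrightarrow> (\<And>x. a \<le> x \<Longrightarrow> x < T \<Longrightarrow> m x > 0) \<Longrightarrow> m T > 0"
  shows "m b > 0"
proof (rule ccontr)
  assume "\<not> m b > 0"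
  define S where "S = {x \<in> {a..b}. m x \<le> 0}"
  have "closed S"
    unfolding S_def by (intro continuous_on_closed_Collect_le assms(2) continuous_on_const closed_atLeastAtMost)
  moreover have "S \<noteq> {}" "bdd_below S"
    using \<open>\<not> m b > 0\<close> assms(1) by (auto simp: S_def intro!: bdd_belowI[of _ a])
  ultimately have S: "closed S" "S \<noteq> {}" "bdd_below S" by auto
  define T where "T = Inf S"
  have T: "T \<in> S" unfolding T_def using S by (intro closed_contains_Inf)
  then have "a < T" using assms(3) by (cases "T = a") (auto simp: S_def)
  moreover have "m x > 0" if "a \<le> x" "x < T" for x
  proof (rule ccontr)
    assume "\<not> m x > 0"
    then have "x \<in> S" using that T by (auto simp: S_def)
    then show False using that cInf_lower[OF _ S(3)] by (force simp: T_def)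
  qed
  ultimately show False using step[of T] T by (auto simp: S_def)
qed

text \<open>The integrating factor \<open>exp (K * x)\<close> makes the product nondecreasing. The
  estimate is asked only on the open interval, since at a first exit time \<open>T\<close> itself
  the signs needed to prove it are not yet known.\<close>

lemma gronwall_pos:
  fixes y :: "real \<Rightarrow> real"
  assumes "a < T" "y a > 0"
    and d: "\<And>x. a \<le> x \<Longrightarrow> x \<le> T \<Longrightarrow> (y has_real_derivative y' x) (at x)"
    and ge: "\<And>x. a < x \<Longrightarrow> x < T \<Longrightarrow> y' x \<ge> - K * y x"
  shows "y T > 0"
proof -
  define f where "f x = y x * exp (K * x)" for x
  have fd: "(f has_real_derivative exp (K * x) * (y' x + K * y x)) (at x)" if "a \<le> x" "x \<le> T" for x
    unfolding f_def[abs_def]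
    by (rule derivative_eq_intros d that refl)+ (simp add: algebra_simps)
  have "f a \<le> f T"
  proof (rule DERIV_nonneg_imp_increasing_open[where f = f])
    show "\<exists>z. (f has_real_derivative z) (at x) \<and> 0 \<le> z" if "a < x" "x < T" for x
      using fd[of x] ge[OF that] that by (intro exI[of _ "exp (K * x) * (y' x + K * y x)"]) auto
    show "continuous_on {a..T} f"
      by (intro continuous_at_imp_continuous_on ballI DERIV_isCont[OF fd]) auto
  qed (use assms(1) in simp)
  moreover have "f a > 0" using assms(2) by (simp add: f_def)
  ultimately have "f T > 0" by simp
  then show ?thesis by (simp add: f_def zero_less_mult_iff)
qed

section \<open>Trajectories of regular solutions in the phase plane\<close>

context hessian_solution
begin

lemma k_beta: "real k * \<beta> = real n - 2 * real k"
  using k_gt_1 by (simp add: \<beta>_def)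

text \<open>L'Hospital's rule, with the equation supplying the derivative of \<open>w\<close> and
  \<open>w_tendsto_0\<close> the vanishing numerator.\<close>

lemma w_over_power_tendsto:
  assumes "(u \<longlongrightarrow> \<rho>) (at_right 0)" "\<rho> > 0"
  shows "((\<lambda>r. w r / r ^ n) \<longlongrightarrow> - (real k / c * \<rho> powr p / real n)) (at_right 0)"
proof (rule lhopital_right_0)
  have ev: "eventually (\<lambda>r. r > (0::real)) (at_right 0)" by (rule eventually_at_right_less)
  show "(w \<longlongrightarrow> 0) (at_right 0)" by (rule w_tendsto_0)
  show "((\<lambda>r::real. r ^ n) \<longlongrightarrow> 0) (at_right 0)"
    using n_gt by (intro tendsto_eq_intros) auto
  show "eventually (\<lambda>r::real. r ^ n \<noteq> 0) (at_right 0)"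
    using ev by eventually_elim simp
  show "eventually (\<lambda>r::real. real n * r ^ (n - 1) \<noteq> 0) (at_right 0)"
    using ev by eventually_elim (use n_gt in simp)
  show "eventually (\<lambda>r. (w has_real_derivative - (real k / c) * (r ^ (n - 1) * u r powr p)) (at r)) (at_right 0)"
    using ev by eventually_elim (rule w_deriv)
  show "eventually (\<lambda>r. ((\<lambda>r. r ^ n) has_real_derivative real n * r ^ (n - 1)) (at r)) (at_right 0)"
    by (intro always_eventually allI) (auto intro!: derivative_eq_intros)
  show "((\<lambda>r. - (real k / c) * (r ^ (n - 1) * u r powr p) / (real n * r ^ (n - 1)))
      \<longlongrightarrow> - (real k / c * \<rho> powr p / real n)) (at_right 0)"
  proof (rule Lim_transform_eventually)
    show "((\<lambda>r. - (real k / c * u r powr p / real n)) \<longlongrightarrow> - (real k / c * \<rho> powr p / real n)) (at_right 0)"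
      using assms n_gt by (intro tendsto_intros) auto
    show "eventually (\<lambda>r. - (real k / c * u r powr p / real n)
        = - (real k / c) * (r ^ (n - 1) * u r powr p) / (real n * r ^ (n - 1))) (at_right 0)"
      using ev by eventually_elim simp
  qed
qed

lemma Z_tendsto:
  assumes "(u \<longlongrightarrow> \<rho>) (at_right 0)" "\<rho> > 0"
  shows "(Z \<longlongrightarrow> real n) (at_right 0)"
proof (rule Lim_transform_eventually)
  have ne: "real k / c * \<rho> powr p / real n \<noteq> 0" using k_gt_1 c_pos assms(2) n_gt by simp
  have "((\<lambda>r. real k / c * u r powr p / (- (w r / r ^ n)))
      \<longlongrightarrow> real k / c * \<rho> powr p / (- (- (real k / c * \<rho> powr p / real n)))) (at_right 0)"
    using assms ne by (intro tendsto_intros w_over_power_tendsto) auto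
  also have "real k / c * \<rho> powr p / (- (- (real k / c * \<rho> powr p / real n))) = real n"
    using ne by simp
  finally show "((\<lambda>r. real k / c * u r powr p / (- (w r / r ^ n))) \<longlongrightarrow> real n) (at_right 0)" .
  show "eventually (\<lambda>r. real k / c * u r powr p / (- (w r / r ^ n)) = Z r) (at_right 0)"
    using eventually_at_right_less[of 0] by eventually_elim (simp add: Z_def)
qed

text \<open>Since \<open>(- r * deriv u r) ^ k = - w r / r ^ n * r ^ (2 * k)\<close>,
  \<open>X\<close> is a \<open>k\<close>-th root of a quantity tending to 0, divided by
  \<open>u\<close>.\<close>

lemma X_tendsto:
  assumes "(u \<longlongrightarrow> \<rho>) (at_right 0)" "\<rho> > 0"
  shows "(X \<longlongrightarrow> 0) (at_right 0)"
proof (rule Lim_transform_eventually)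
  have "((\<lambda>r. (- (w r / r ^ n) * r ^ (2 * k)) powr (1 / real k) / u r)
      \<longlongrightarrow> (- (- (real k / c * \<rho> powr p / real n)) * 0 ^ (2 * k)) powr (1 / real k) / \<rho>) (at_right 0)"
  proof (intro tendsto_intros tendsto_powr' w_over_power_tendsto assms)
    \<comment> \<open>The base tends to 0, so the limit rule asks for a positive exponent and an
      eventually nonnegative base.\<close>
    show "- (- (real k / c * \<rho> powr p / real n)) * 0 ^ (2 * k) \<noteq> 0 \<or>
      0 < 1 / real k \<and> (\<forall>\<^sub>F r in at_right 0. 0 \<le> - (w r / r ^ n) * r ^ (2 * k))"
      using k_gt_1 eventually_mono[OF eventually_at_right_less[of 0], of "\<lambda>r. 0 \<le> - (w r / r ^ n) * r ^ (2 * k)"]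
      by (simp add: w_neg less_imp_le divide_nonpos_pos mult_nonpos_nonneg)
  qed (use assms in auto)
  then show "((\<lambda>r. (- (w r / r ^ n) * r ^ (2 * k)) powr (1 / real k) / u r) \<longlongrightarrow> 0) (at_right 0)"
    using k_gt_1 by (simp add: zero_power)
  show "eventually (\<lambda>r. (- (w r / r ^ n) * r ^ (2 * k)) powr (1 / real k) / u r = X r) (at_right 0)"
    using eventually_at_right_less[of 0]
  proof eventually_elim
    case (elim r)
    define d where "d = - deriv u r"
    have d: "d > 0" using deriv_u_neg[OF elim] by (simp add: d_def)
    have "r ^ n * r ^ k = r ^ (n - k) * r ^ (2 * k)"
      using n_gt by (simp add: add.commute flip: power_add)
    then have "(r * d) ^ k * r ^ n = (r ^ (n - k) * d ^ k) * r ^ (2 * k)"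
      by (simp add: power_mult_distrib mult_ac)
    also have "r ^ (n - k) * d ^ k = - w r"
      using w_neg_imp(2)[OF elim w_neg[OF elim]] by (simp add: d_def)
    finally have "- (w r / r ^ n) * r ^ (2 * k) = (r * d) ^ k"
      using elim by (simp add: field_simps)
    then have "(- (w r / r ^ n) * r ^ (2 * k)) powr (1 / real k) = ((r * d) ^ k) powr (1 / real k)"
      by simp
    also have "\<dots> = r * d"
      using k_gt_1 d elim by (simp add: powr_realpow[symmetric] powr_powr)
    finally show ?case by (simp add: X_def d_def)
  qed
qed

text \<open>At the critical exponent the trajectory stays on the invariant line through \<open>(0, n)\<close> and
  \<open>(\<beta>, 0)\<close> of the \<open>(X, Z)\<close>-plane: the quantity \<open>P\<close> is, up to a constant, the Pohozaev integral.\<close>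

lemma critical_line:
  assumes lim: "(u \<longlongrightarrow> \<rho>) (at_right 0)" "\<rho> > 0" and p: "p = p_so n k" and r: "r > 0"
  shows "X r / \<beta> + Z r / real n = 1"
proof -
  define P where "P s = (X s / \<beta> + Z s / real n - 1) * (w s * u s)" for s
  have N: "real n > 0" using n_gt by simp
  \<comment> \<open>This balance characterises \<open>p_so\<close>; it cancels the derivative of
    \<open>P\<close> below.\<close>
  have pe: "(real k + 1) / (real k * \<beta>) = (p + 1) / real n"
  proof -
    have "real (2 * k) < real n" using n_gt by (simp only: of_nat_less_iff)
    then show ?thesis unfolding k_beta p p_so_def using N by (simp add: field_simps)
  qed
  have P': "(P has_real_derivative 0) (at s)" if s: "s > 0" for s
  proof -
    have ue: "deriv u s = - X s * u s / s" using u_pos[OF s] s by (simp add: X_def)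
    note dL = DERIV_diff[OF DERIV_add[OF DERIV_cdivide[OF X_deriv[OF s], of \<beta>]
      DERIV_cdivide[OF Z_deriv[OF s], of "real n"]] DERIV_const[of 1]]
    have "(P has_real_derivative (X s / s * (X s + Z s / real k - \<beta>) / \<beta>
         + Z s / s * (real n - p * X s - Z s) / real n) * (w s * u s)
       + (X s / \<beta> + Z s / real n - 1) * (Z s * w s / s * u s + w s * (- X s * u s / s))) (at s)"
      unfolding P_def[abs_def] ue[symmetric]
      by (rule DERIV_cong[OF DERIV_mult[OF dL DERIV_mult[OF w_deriv'[OF s] u_deriv[OF s]]]])
         (simp add: algebra_simps)
    also have "(X s / s * (X s + Z s / real k - \<beta>) / \<beta>
         + Z s / s * (real n - p * X s - Z s) / real n) * (w s * u s)
       + (X s / \<beta> + Z s / real n - 1) * (Z s * w s / s * u s + w s * (- X s * u s / s))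
      = X s * Z s * (w s * u s) / s * ((real k + 1) / (real k * \<beta>) - (p + 1) / real n)"
      using beta_pos N k_gt_1 s by (simp add: divide_simps) (simp add: algebra_simps)
    finally show ?thesis using pe by simp
  qed
  then obtain C where C: "\<And>s. s > 0 \<Longrightarrow> P s = C"
    using has_field_derivative_zero_constant[of "{0<..}" P]
    by (metis convex_real_interval(3) greaterThan_iff has_field_derivative_at_within)
  \<comment> \<open>The limit at the origin identifies the constant value of \<open>P\<close> as 0,
    and \<open>w * u\<close> has no zero.\<close>
  have "(P \<longlongrightarrow> (0 / \<beta> + real n / real n - 1) * (0 * \<rho>)) (at_right 0)"
    unfolding P_def[abs_def] using beta_pos N
    by (intro tendsto_intros X_tendsto[OF lim] Z_tendsto[OF lim] w_tendsto_0 lim(1)) auto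
  moreover have "(P \<longlongrightarrow> C) (at_right 0)"
    by (rule Lim_transform_eventually[OF tendsto_const])
       (use C in \<open>auto intro: eventually_mono[OF eventually_at_right_less]\<close>)
  ultimately have "C = 0" using tendsto_unique[of "at_right (0::real)"] by force
  then show ?thesis using C[OF r] w_neg[OF r] u_pos[OF r] by (simp add: P_def)
qed

text \<open>On the invariant line the equation for \<open>X\<close> reduces to
  \<open>r X' = 2 X Z / n > 0\<close>, so \<open>X\<close> is strictly increasing and takes the
  value \<alpha> at most once.\<close>

lemma critical_avoids:
  assumes lim: "(u \<longlongrightarrow> \<rho>) (at_right 0)" "\<rho> > 0" and p: "p = p_so n k"
  shows "\<exists>R>0. \<forall>r>R. X r \<noteq> \<alpha>"
proof (cases "\<exists>s>0. X s = \<alpha>")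
  case False
  then show ?thesis by (intro exI[of _ 1]) auto
next
  case True
  then obtain s where s: "s > 0" "X s = \<alpha>" by blast
  have N: "real n > 0" using n_gt by simp
  have X': "(X has_real_derivative X r / r * (2 * Z r / real n)) (at r)" if r: "r > 0" for r
  proof -
    have Zr: "Z r = real n * (1 - X r / \<beta>)"
      using critical_line[OF lim p r] N by (simp add: field_simps)
    have "real n = real k * \<beta> + 2 * real k" using k_beta by simp
    then have "X r + Z r / real k - \<beta> = 2 * (1 - X r / \<beta>)"
      unfolding Zr using beta_pos k_gt_1 by (simp add: field_simps)
    also have "\<dots> = 2 * Z r / real n" unfolding Zr using N by simp
    finally show ?thesis using X_deriv[OF r] by simp
  qed
  have "X s < X r" if "r > s" for r
  proof (rule DERIV_pos_imp_increasing[where f = X, OF that])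
    fix x assume "s \<le> x" "x \<le> r"
    then have x: "x > 0" using s by simp
    show "\<exists>y. (X has_real_derivative y) (at x) \<and> 0 < y"
      using X'[OF x] X_pos[OF x] Z_pos[OF x] N x
      by (intro exI[of _ "X x / x * (2 * Z x / real n)"]) simp
  qed
  then show ?thesis using s by (intro exI[of _ s]) force
qed

text \<open>With \<open>\<xi> = \<alpha> - X\<close> and \<open>\<zeta> = Z - k (\<beta> - \<alpha>)\<close> the deviations from the equilibrium, the region
  \<open>\<xi> > 0\<close>, \<open>\<zeta> < \<mu> \<xi>\<close> is invariant when \<open>\<mu>\<close> is an eigenslope of the linearisation there; the
  trajectory starts with \<open>\<zeta> / \<xi> = p < \<mu>\<close>.\<close>

lemma supercritical_X_less:
  assumes lim: "(u \<longlongrightarrow> \<rho>) (at_right 0)" "\<rho> > 0" and p: "p > real k"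
    and mu: "\<mu> > p" "\<mu>\<^sup>2 * \<alpha> / real k - \<mu> * (\<alpha> + Z0) + p * Z0 = 0"
    and Z0: "Z0 = real k * (\<beta> - \<alpha>)" "Z0 > 0" and b: "b > 0"
  shows "X b < \<alpha>"
proof -
  have k0: "real k > 0" using k_gt_1 by simp
  have al: "\<alpha> > 0" using p k0 by (simp add: \<alpha>_def)
  \<comment> \<open>The equilibrium \<open>(\<alpha>, Z0)\<close> lies on the nullcline
    \<open>n = p * X + Z\<close>.\<close>
  have n_eq: "real n = p * \<alpha> + Z0"
  proof -
    have "(p - real k) * \<alpha> = 2 * real k" using p by (simp add: \<alpha>_def)
    then show ?thesis using k_beta by (simp add: Z0(1) algebra_simps)
  qed
  have mu_k: "\<mu> > real k" "\<mu> > 0" using mu p k0 by auto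
  define \<xi> where "\<xi> r = \<alpha> - X r" for r
  define g where "g r = \<mu> * \<xi> r - (Z r - Z0)" for r
  have \<xi>': "(\<xi> has_real_derivative X r * (\<xi> r * (1 - \<mu> / real k) + g r / real k) / r) (at r)" if r: "r > 0" for r
    unfolding \<xi>_def[abs_def]
    by (rule derivative_eq_intros X_deriv r refl)+
       (use k0 r in \<open>simp add: \<xi>_def g_def Z0 field_simps\<close>)
  define g' where "g' r = \<mu> * (X r * (\<xi> r * (1 - \<mu> / real k) + g r / real k) / r)
      - Z r / r * (real n - p * X r - Z r)" for r
  have g': "(g has_real_derivative g' r) (at r)" if r: "r > 0" for r
    unfolding g_def[abs_def]
    by (rule derivative_eq_intros \<xi>' Z_deriv r refl)+ (simp add: g'_def)
  have g'_ge: "g' r \<ge> g r * (\<mu> * X r / real k - Z r - \<xi> r * (\<mu> - p)) / r" if r: "r > 0" and x: "\<xi> r > 0" for r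
  proof -
    have Xe: "X r = \<alpha> - \<xi> r" and Ze: "Z r = Z0 - g r + \<mu> * \<xi> r" by (auto simp: \<xi>_def g_def)
    \<comment> \<open>Once the multiple of \<open>g\<close> is split off, the part linear in \<xi>
      is the eigenslope polynomial, zero by \<open>mu(2)\<close>; the quadratic remainder is
      nonnegative as \<mu> exceeds both \<open>p\<close> and \<open>k\<close>.\<close>
    have "r * g' r - g r * (\<mu> * X r / real k - Z r - \<xi> r * (\<mu> - p))
       = \<xi> r * (\<mu> * \<xi> r * (\<mu> - p) + \<mu> * \<xi> r * (\<mu> / real k - 1)
           - (\<mu>\<^sup>2 * \<alpha> / real k - \<mu> * (\<alpha> + Z0) + p * Z0))"
      unfolding g'_def n_eq Xe Ze using r k0
      by (simp add: field_simps power2_eq_square)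
    also have "\<dots> \<ge> 0"
    proof -
      have "\<mu> / real k - 1 \<ge> 0" using mu_k k0 by simp
      then show ?thesis unfolding mu(2) using mu mu_k x by simp
    qed
    finally show ?thesis using r by (simp add: field_simps)
  qed
  \<comment> \<open>Positivity of the minimum encodes both inequalities, so one first-exit argument
    preserves them together; each is used in the estimate of the other.\<close>
  define m where "m r = min (\<xi> r) (g r)" for r
  have "(\<xi> \<longlongrightarrow> \<alpha> - 0) (at_right 0)"
    unfolding \<xi>_def[abs_def] by (intro tendsto_intros X_tendsto[OF lim])
  then have \<xi>lim: "(\<xi> \<longlongrightarrow> \<alpha>) (at_right 0)" by simp
  have "(g \<longlongrightarrow> \<mu> * \<alpha> - (real n - Z0)) (at_right 0)"
    unfolding g_def[abs_def] by (intro tendsto_intros \<xi>lim Z_tendsto[OF lim])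
  moreover have "\<mu> * \<alpha> - (real n - Z0) > 0" using n_eq mu al by simp
  ultimately have "eventually (\<lambda>r. g r > 0) (at_right 0)" by (rule order_tendstoD(1))
  with order_tendstoD(1)[OF \<xi>lim al] have "eventually (\<lambda>r. m r > 0) (at_right 0)"
    by eventually_elim (simp add: m_def)
  with order_tendstoD(2)[OF tendsto_ident_at b] eventually_at_right_less[of 0]
  have "eventually (\<lambda>a. 0 < a \<and> a < b \<and> m a > 0) (at_right 0)"
    by eventually_elim simp
  then obtain a where a: "0 < a" "a < b" "m a > 0"
    using eventually_happens'[of "at_right (0::real)"] by force
  have "m b > 0"
  proof (rule continuous_first_exit[of a b m])
    show "continuous_on {a..b} m"
      unfolding m_def[abs_def] using a
      by (intro continuous_intros continuous_at_imp_continuous_on ballI DERIV_isCont[OF \<xi>'] DERIV_isCont[OF g']) auto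
    fix T assume T: "a < T" "T \<le> b" and pos: "\<And>x. a \<le> x \<Longrightarrow> x < T \<Longrightarrow> m x > 0"
    have pos': "\<xi> x > 0" "g x > 0" "x > 0" "X x > 0" "X x < \<alpha>" "Z x > 0" "Z x < Z0 + \<mu> * \<alpha>"
      if "a \<le> x" "x < T" for x
    proof -
      show x: "x > 0" using that a by simp
      show X: "X x > 0" "Z x > 0" by (rule X_pos[OF x], rule Z_pos[OF x])
      show *: "\<xi> x > 0" "g x > 0" using pos[OF that] by (auto simp: m_def)
      then show "X x < \<alpha>" by (simp add: \<xi>_def)
      have "\<mu> * \<xi> x < \<mu> * \<alpha>" using X mu_k by (simp add: \<xi>_def)
      then show "Z x < Z0 + \<mu> * \<alpha>" using *(2) by (simp add: g_def)
    qed
    \<comment> \<open>Before \<open>T\<close> the region gives \<open>X x < \<alpha>\<close>, and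
      \<open>x \<ge> a\<close>, which bounds the negative rate
      \<open>X x / x * (1 - \<mu> / k)\<close> from below; the term with \<open>g\<close> only
      helps.\<close>
    have "\<xi> T > 0"
    proof (rule gronwall_pos[of a T \<xi> _ "\<alpha> / a * (\<mu> / real k - 1)"])
      show "(\<xi> has_real_derivative X x * (\<xi> x * (1 - \<mu> / real k) + g x / real k) / x) (at x)"
        if "a \<le> x" "x \<le> T" for x using \<xi>' that a by simp
      fix x assume x: "a < x" "x < T"
      note px = pos'[OF less_imp_le[OF x(1)] x(2)]
      have "X x / x * (\<mu> / real k - 1) \<le> \<alpha> / a * (\<mu> / real k - 1)"
      proof (rule mult_right_mono)
        show "X x / x \<le> \<alpha> / a" using px x a by (intro frac_le) auto
        show "0 \<le> \<mu> / real k - 1" using mu_k k0 by simp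
      qed
      then have "X x / x * (\<mu> / real k - 1) * \<xi> x \<le> \<alpha> / a * (\<mu> / real k - 1) * \<xi> x"
        by (rule mult_right_mono) (use px in simp)
      moreover have "X x * (\<xi> x * (1 - \<mu> / real k) + g x / real k) / x
          = X x * g x / (real k * x) - X x / x * (\<mu> / real k - 1) * \<xi> x"
        using k0 px by (simp add: field_simps)
      moreover have "X x * g x / (real k * x) \<ge> 0" using px k0 by simp
      ultimately show "- (\<alpha> / a * (\<mu> / real k - 1)) * \<xi> x
          \<le> X x * (\<xi> x * (1 - \<mu> / real k) + g x / real k) / x" by simp
    qed (use T pos'[of a] in auto)
    \<comment> \<open>Here \<open>Z x < Z0 + \<mu> * \<alpha>\<close> and
      \<open>\<xi> x < \<alpha>\<close> bound the rate found in \<open>g'_ge\<close>.\<close>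
    moreover have "g T > 0"
    proof (rule gronwall_pos[of a T g g' "(Z0 + \<mu> * \<alpha> + \<alpha> * (\<mu> - p)) / a"])
      show "(g has_real_derivative g' x) (at x)" if "a \<le> x" "x \<le> T" for x using g' that a by simp
      fix x assume x: "a < x" "x < T"
      note px = pos'[OF less_imp_le[OF x(1)] x(2)]
      have "\<xi> x * (\<mu> - p) \<le> \<alpha> * (\<mu> - p)"
        using px mu by (intro mult_right_mono) (auto simp: \<xi>_def)
      moreover have "\<mu> * X x / real k \<ge> 0" using px mu_k k0 by simp
      ultimately have "Z x + \<xi> x * (\<mu> - p) - \<mu> * X x / real k \<le> Z0 + \<mu> * \<alpha> + \<alpha> * (\<mu> - p)"
        using px by simp
      moreover have "0 \<le> Z0 + \<mu> * \<alpha> + \<alpha> * (\<mu> - p)" using Z0 mu mu_k al by simp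
      ultimately have "(Z x + \<xi> x * (\<mu> - p) - \<mu> * X x / real k) / x \<le> (Z0 + \<mu> * \<alpha> + \<alpha> * (\<mu> - p)) / a"
        using x a by (intro order.trans[OF divide_right_mono frac_le]) auto
      then have "g x * ((Z x + \<xi> x * (\<mu> - p) - \<mu> * X x / real k) / x) \<le> g x * ((Z0 + \<mu> * \<alpha> + \<alpha> * (\<mu> - p)) / a)"
        using px by (intro mult_left_mono) auto
      moreover have "g x * (\<mu> * X x / real k - Z x - \<xi> x * (\<mu> - p)) / x
          = - (g x * ((Z x + \<xi> x * (\<mu> - p) - \<mu> * X x / real k) / x))"
        using px by (simp add: field_simps)
      ultimately show "- ((Z0 + \<mu> * \<alpha> + \<alpha> * (\<mu> - p)) / a) * g x \<le> g' x"
        using g'_ge[OF px(3) px(1)] by (simp add: mult.commute)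
    qed (use T pos'[of a] in auto)
    ultimately show "m T > 0" by (simp add: m_def)
  qed (use a in auto)
  then show ?thesis by (simp add: m_def \<xi>_def)
qed

end

section \<open>Algebra of the Joseph-Lundgren exponent\<close>

text \<open>The slope equation has the discriminant of the linearisation at the equilibrium, and
  \<open>p \<ge> p_jl\<close> makes it nonnegative: the equilibrium is a node rather than a focus.
  The root above \<open>p\<close> is the barrier slope for
  \<open>supercritical_X_less\<close>.\<close>

lemma p_jl_eigenslope:
  fixes n k :: nat and p \<alpha> :: real
  assumes k: "1 < k" and n: "2 * k + 8 < n" and p: "p_jl n k \<le> ereal p"
  defines "\<alpha> \<equiv> 2 * real k / (p - real k)"
  defines "Z0 \<equiv> real n - 2 * real k - real k * \<alpha>"
  shows "p > real k \<and> Z0 > 0 \<and> (\<exists>\<mu>>p. \<mu>\<^sup>2 * \<alpha> / real k - \<mu> * (\<alpha> + Z0) + p * Z0 = 0)"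
proof -
  define K where "K = real k"
  define N where "N = real n - 2 * K"
  define S where "S = sqrt (2 * (K + 1) * real n - 4 * K)"
  \<comment> \<open>\<open>E + 2 * S\<close> and \<open>E - 2 * S\<close> are the values of
    \<open>(K + 1)\<^sup>2 * \<alpha>\<close> at which the discriminant
    \<open>(Z0 - \<alpha>)\<^sup>2 - 8 * Z0\<close> vanishes.\<close>
  define E where "E = (K + 1) * N - 4 * K"
  have K: "K > 1" using k by (simp add: K_def)
  have "real (2 * k + 8) < real n" using n by (simp only: of_nat_less_iff)
  then have N: "N > 8" by (simp add: N_def K_def)
  have n_eq: "real n = N + 2 * K" by (simp add: N_def)
  have "K * 8 \<le> K * N" using K N by (intro mult_left_mono) auto
  moreover have "E = K * N + N - 4 * K" by (simp add: E_def algebra_simps)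
  ultimately have E: "E > 0" using K N by linarith
  have arg: "2 * (K + 1) * real n - 4 * K = 2 * (K + 1) * N + 4 * K * K"
    by (simp add: n_eq algebra_simps)
  have S2: "S\<^sup>2 = 2 * (K + 1) * N + 4 * K * K" and S0: "S \<ge> 0"
    using K N unfolding S_def arg by auto
  \<comment> \<open>This conjugation turns the bound \<open>N * (N - 8) / (E + 2 * S)\<close> on
    \<alpha> into one by the smaller root.\<close>
  have ES: "(E + 2 * S) * (E - 2 * S) = (K + 1)\<^sup>2 * (N * (N - 8))"
  proof -
    have "(E + 2 * S) * (E - 2 * S) = E\<^sup>2 - 4 * S\<^sup>2" by (simp add: algebra_simps power2_eq_square)
    then show ?thesis unfolding S2 by (simp add: E_def algebra_simps power2_eq_square)
  qed
  have NN: "N * (N - 8) > 0" using N by simp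
  have "(K * ((real n)\<^sup>2 - 2 * (K + 3) * real n + 4 * K) + 4 * K * S) / (N * (N - 8)) \<le> p"
    using p n unfolding p_jl_def by (simp add: K_def N_def S_def)
  moreover have "(K * ((real n)\<^sup>2 - 2 * (K + 3) * real n + 4 * K) + 4 * K * S) / (N * (N - 8))
      = K + 2 * K * (E + 2 * S) / (N * (N - 8))"
  proof -
    have "K * ((real n)\<^sup>2 - 2 * (K + 3) * real n + 4 * K) + 4 * K * S
        = K * (N * (N - 8)) + 2 * K * (E + 2 * S)"
      by (simp add: n_eq E_def algebra_simps power2_eq_square)
    then show ?thesis using N by (simp only: add_divide_distrib) simp
  qed
  ultimately have pk: "2 * K * (E + 2 * S) / (N * (N - 8)) \<le> p - K" by simp
  have lpos: "2 * K * (E + 2 * S) / (N * (N - 8)) > 0" using NN E S0 K by simp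
  then have p_gt: "p > K" using pk by simp
  have "\<alpha> \<le> 2 * K / (2 * K * (E + 2 * S) / (N * (N - 8)))"
    unfolding \<alpha>_def K_def[symmetric] using K by (intro frac_le pk lpos) auto
  also have "\<dots> = N * (N - 8) / (E + 2 * S)" using K by simp
  also have "\<dots> = (E - 2 * S) / (K + 1)\<^sup>2"
    using ES E S0 K by (simp add: field_simps)
  finally have al: "(K + 1)\<^sup>2 * \<alpha> \<le> E - 2 * S"
    using K by (simp add: field_simps)
  have al0: "\<alpha> > 0" using p_gt K by (simp add: \<alpha>_def K_def)
  have pa: "p * \<alpha> = 2 * K + K * \<alpha>"
    using p_gt by (simp add: \<alpha>_def K_def field_simps)
  have Z0: "Z0 = N - K * \<alpha>" by (simp add: Z0_def N_def K_def)
  \<comment> \<open>The discriminant sees \<open>Z0 - \<alpha>\<close> only through its square; the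
    sign comes from the bound on \<alpha>.\<close>
  have "(K + 1) * ((K + 1) * \<alpha>) < (K + 1) * N"
  proof -
    have "(K + 1)\<^sup>2 * \<alpha> = (K + 1) * ((K + 1) * \<alpha>)" by (simp add: power2_eq_square)
    then show ?thesis using al S0 K unfolding E_def by linarith
  qed
  then have "(K + 1) * \<alpha> < N" using K by simp
  then have diff: "Z0 - \<alpha> > 0" by (simp add: Z0 algebra_simps)
  then have Zpos: "Z0 > 0" using al0 by simp
  have "(2 * S)\<^sup>2 \<le> (E - (K + 1)\<^sup>2 * \<alpha>)\<^sup>2"
    using al S0 by (intro power_mono) auto
  moreover have "(E - (K + 1)\<^sup>2 * \<alpha>)\<^sup>2 - (2 * S)\<^sup>2 = (K + 1)\<^sup>2 * ((Z0 - \<alpha>)\<^sup>2 - 8 * Z0)"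
  proof -
    have "(2 * S)\<^sup>2 = 4 * S\<^sup>2" by simp
    then show ?thesis unfolding S2 by (simp add: E_def Z0 algebra_simps power2_eq_square)
  qed
  ultimately have "(K + 1)\<^sup>2 * ((Z0 - \<alpha>)\<^sup>2 - 8 * Z0) \<ge> 0" by simp
  then have D: "(Z0 - \<alpha>)\<^sup>2 - 8 * Z0 \<ge> 0" using K by (simp add: zero_le_mult_iff)
  define d where "d = sqrt ((Z0 - \<alpha>)\<^sup>2 - 8 * Z0)"
  have d: "d\<^sup>2 = (Z0 - \<alpha>)\<^sup>2 - 8 * Z0" "d \<ge> 0" using D by (auto simp: d_def)
  have "8 * (Z0 - \<alpha>) < (Z0 - \<alpha>) * (Z0 - \<alpha>)"
    using D al0 by (simp add: power2_eq_square)
  then have d8: "Z0 - \<alpha> > 8" using diff by (simp only: mult_less_cancel_right_pos)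
  \<comment> \<open>The larger root; the discriminant is \<open>d\<^sup>2\<close> because
    \<open>p * \<alpha> = 2 * K + K * \<alpha>\<close>, and \<open>d8\<close> puts the root above
    \<open>p\<close>.\<close>
  define \<mu> where "\<mu> = K * (\<alpha> + Z0 + d) / (2 * \<alpha>)"
  have "2 * (p * \<alpha>) < K * (\<alpha> + Z0 + d)"
  proof -
    have "0 < K * (Z0 - \<alpha> - 8 + d)" using K d8 d by (intro mult_pos_pos) auto
    then show ?thesis unfolding pa using K by (simp add: algebra_simps)
  qed
  then have "\<mu> > p" using al0 by (simp add: \<mu>_def field_simps)
  moreover have "\<mu>\<^sup>2 * \<alpha> / K - \<mu> * (\<alpha> + Z0) + p * Z0 = 0"
  proof -
    have "4 * \<alpha> * (\<mu>\<^sup>2 * \<alpha> / K - \<mu> * (\<alpha> + Z0) + p * Z0)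
        = K * (d\<^sup>2 - (\<alpha> + Z0)\<^sup>2) + 4 * (p * \<alpha>) * Z0"
      using al0 K by (simp add: \<mu>_def field_simps power2_eq_square)
    also have "\<dots> = 0" unfolding d pa by (simp add: algebra_simps power2_eq_square)
    finally show ?thesis using al0 by simp
  qed
  ultimately show ?thesis using p_gt Zpos by (auto simp: K_def)
qed

section \<open>Solutions with fast decay at infinity\<close>

context hessian_solution
begin

text \<open>Here \<open>- deriv u r = y r * r powr (- \<beta> - 1)\<close> with \<open>y\<close>
  increasing to a finite \<open>Y\<close>. Integrating to infinity gives
  \<open>\<beta> * u r * r powr \<beta> \<le> Y\<close>, hence
  \<open>X r \<ge> \<beta> * y r / Y\<close>, which eventually exceeds \<alpha>.\<close>

lemma fast_decay_avoids:
  assumes "\<alpha> < \<beta>" and inf: "((\<lambda>r. u r * r powr \<beta>) \<longlongrightarrow> lam) at_top"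
  shows "\<exists>R>0. \<forall>r>R. X r \<noteq> \<alpha>"
proof -
  define y where "y r = (- w r) powr (1 / real k)" for r
  have y_pos: "y r > 0" if "r > 0" for r
    using w_neg[OF that] by (simp add: y_def)
  have y_mono: "y r \<le> y s" if "0 < r" "r \<le> s" for r s
    unfolding y_def using w_strict_antimono[of r s] w_neg[of r] that
    by (cases "r = s") (auto intro!: powr_mono2)
  have du: "deriv u r = - (y r * r powr (- \<beta> - 1))" if r: "r > 0" for r
    using w_neg_imp(3)[OF r w_neg[OF r]] root_power[OF r, of "- w r"] w_neg[OF r]
    by (simp add: y_def)
  have powr_lim: "((\<lambda>r. r powr - \<beta>) \<longlongrightarrow> 0) at_top"
    using beta_pos by (intro tendsto_neg_powr filterlim_ident) auto
  have u_lim: "(u \<longlongrightarrow> 0) at_top"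
  proof (rule Lim_transform_eventually)
    show "((\<lambda>r. (u r * r powr \<beta>) * r powr - \<beta>) \<longlongrightarrow> 0) at_top"
      using tendsto_mult[OF inf powr_lim] by simp
    show "eventually (\<lambda>r. (u r * r powr \<beta>) * r powr - \<beta> = u r) at_top"
      using eventually_gt_at_top[of 0] by eventually_elim (simp add: mult.assoc powr_add[symmetric])
  qed
  \<comment> \<open>Subtracting the constant-flux profile: \<open>h C\<close> is monotone where
    \<open>C - y\<close> keeps its sign and vanishes at infinity, which fixes its sign.
    \<open>ub\<close> takes \<open>C = y r\<close>, \<open>lb\<close> takes
    \<open>C = Y\<close>.\<close>
  define h where "h C r = u r - C / \<beta> * r powr - \<beta>" for C r
  have h': "(h C has_real_derivative (C - y r) * r powr (- \<beta> - 1)) (at r)" if "r > 0" for C r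
    unfolding h_def[abs_def] using that beta_pos du[OF that]
    by (auto intro!: derivative_eq_intros u_deriv simp: algebra_simps)
  have h_lim: "(h C \<longlongrightarrow> 0) at_top" for C
    unfolding h_def[abs_def] using tendsto_diff[OF u_lim tendsto_mult_right_zero[OF powr_lim, of "C / \<beta>"]] by simp
  have ub: "y r \<le> \<beta> * (u r * r powr \<beta>)" if r: "r > 0" for r
  proof -
    have "h (y r) s \<le> h (y r) r" if "r \<le> s" for s
    proof (rule DERIV_nonpos_imp_nonincreasing[where f = "h (y r)", OF that])
      fix x assume "r \<le> x" "x \<le> s"
      then show "\<exists>z. (h (y r) has_real_derivative z) (at x) \<and> z \<le> 0"
        using h'[of x "y r"] y_mono[of r x] r
        by (intro exI[of _ "(y r - y x) * x powr (- \<beta> - 1)"]) (auto intro: mult_nonpos_nonneg)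
    qed
    then have "0 \<le> h (y r) r"
      by (intro tendsto_upperbound[OF h_lim]) (auto simp: eventually_at_top_linorder)
    then have "y r / \<beta> * r powr - \<beta> * r powr \<beta> \<le> u r * r powr \<beta>"
      by (intro mult_right_mono) (auto simp: h_def)
    moreover have "y r / \<beta> * r powr - \<beta> * r powr \<beta> = y r / \<beta>"
      using r by (simp add: mult.assoc powr_add[symmetric])
    ultimately have "y r / \<beta> \<le> u r * r powr \<beta>" by (simp only:)
    then show ?thesis using beta_pos by (simp add: field_simps)
  qed
  \<comment> \<open>Monotonicity of \<open>y\<close> carries \<open>ub\<close> to infinity, where
    the assumed decay gives a finite bound; hence the supremum \<open>Y\<close> is
    meaningful.\<close>
  have bound: "y r \<le> \<beta> * lam" if r: "r > 0" for r
  proof (rule tendsto_lowerbound)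
    show "((\<lambda>r. \<beta> * (u r * r powr \<beta>)) \<longlongrightarrow> \<beta> * lam) at_top"
      by (intro tendsto_intros inf)
    show "eventually (\<lambda>s. y r \<le> \<beta> * (u s * s powr \<beta>)) at_top"
      using eventually_ge_at_top[of r]
    proof eventually_elim
      case (elim s)
      then show ?case using y_mono[of r s] ub[of s] r by simp
    qed
  qed simp
  define Y where "Y = (SUP r\<in>{0<..}. y r)"
  have bdd: "bdd_above (y ` {0<..})" using bound by (auto intro!: bdd_aboveI2)
  have Y: "y r \<le> Y" if "r > 0" for r
    unfolding Y_def using that by (intro cSUP_upper bdd) auto
  have Y_pos: "Y > 0" using Y[of 1] y_pos[of 1] by simp
  have lb: "u r * r powr \<beta> \<le> Y / \<beta>" if r: "r > 0" for r
  proof -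
    have "h Y r \<le> h Y s" if "r \<le> s" for s
    proof (rule DERIV_nonneg_imp_nondecreasing[where f = "h Y", OF that])
      fix x assume "r \<le> x" "x \<le> s"
      then show "\<exists>z. (h Y has_real_derivative z) (at x) \<and> z \<ge> 0"
        using h'[of x Y] Y[of x] r
        by (intro exI[of _ "(Y - y x) * x powr (- \<beta> - 1)"]) auto
    qed
    then have "h Y r \<le> 0"
      by (intro tendsto_lowerbound[OF h_lim]) (auto simp: eventually_at_top_linorder)
    then have "u r * r powr \<beta> \<le> Y / \<beta> * r powr - \<beta> * r powr \<beta>"
      by (intro mult_right_mono) (auto simp: h_def)
    also have "\<dots> = Y / \<beta>"
      using r by (simp add: mult.assoc powr_add[symmetric])
    finally show ?thesis .
  qed
  \<comment> \<open>As \<open>\<alpha> / \<beta> < 1\<close>, the supremum property provides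
    \<open>s\<close> with \<open>y s\<close> above this fraction of \<open>Y\<close>, and
    \<open>y\<close> stays above it afterwards.\<close>
  have "\<alpha> / \<beta> * Y < Y" using mult_strict_right_mono[OF assms(1) Y_pos] beta_pos
    by (simp add: pos_divide_less_eq mult.commute)
  then obtain s where s: "s > 0" "\<alpha> / \<beta> * Y < y s"
    unfolding Y_def by (subst (asm) less_cSUP_iff[OF _ bdd]) auto
  have "X r > \<alpha>" if "r > s" for r
  proof -
    have r: "r > 0" using that s by simp
    have "\<alpha> / \<beta> * Y < y r" using s y_mono[of s r] that by simp
    then have "\<alpha> * Y < \<beta> * y r" using beta_pos by (simp add: field_simps)
    moreover have "X r * (u r * r powr \<beta>) = y r"
    proof -
      have "X r * u r = y r * (r * r powr (- \<beta> - 1))"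
        using u_pos[OF r] by (simp add: X_def du[OF r])
      also have "r * r powr (- \<beta> - 1) = r powr - \<beta>" using r by (simp add: powr_diff)
      finally show ?thesis using r by (simp add: mult.assoc[symmetric]) (simp add: mult.assoc powr_add[symmetric])
    qed
    moreover have "X r * (u r * r powr \<beta>) \<le> X r * (Y / \<beta>)"
      using lb[OF r] X_pos[OF r] by (intro mult_left_mono) auto
    ultimately have "\<alpha> * Y < X r * Y" using beta_pos by (simp add: field_simps)
    then show ?thesis using Y_pos by simp
  qed
  then show ?thesis using s by force
qed

end

section \<open>Stability of regular and of fast decaying singular solutions\<close>

theorem theorem1p5:
  fixes n k :: nat and p :: real
  assumes dim: "CARD('n::finite) = n"
    and n3: "n \<ge> 3" and k1: "1 < k" and kn: "2 * k < n"
  shows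
    "((p = p_so n k \<or> ereal p \<ge> max (ereal (p_star n k)) (p_jl n k)) \<longrightarrow>
        (\<forall>\<rho> u. regular_sol TYPE('n) k p \<rho> u \<longrightarrow> (\<exists>R>0. stable_on TYPE('n) k p u R)))
     \<and>
     ((p_se n k < p \<and> p < p_so n k) \<longrightarrow>
        (\<forall>U lam. is_sol n k p U \<and>
           ((\<lambda>r. U r / u_s n k p r) \<longlongrightarrow> 1) (at_right 0) \<and>
           lam > 0 \<and> ((\<lambda>r. U r * r powr ((real n - 2 * real k) / real k)) \<longlongrightarrow> lam) at_top
         \<longrightarrow> (\<exists>R>0. stable_on TYPE('n) k p U R)))"
proof (intro conjI impI allI)
  have "real (2 * k) < real n" using kn by (simp only: of_nat_less_iff)
  then have N: "real n - 2 * real k > 0" by simp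
  have k0: "real k > 0" using k1 by simp
  define b where "b = (real n - 2 * real k) / real k"
  have b: "b > 0" using N k0 by (simp add: b_def)
  {
    fix \<rho> u
    assume p: "p = p_so n k \<or> ereal p \<ge> max (ereal (p_star n k)) (p_jl n k)"
      and reg: "regular_sol TYPE('n) k p \<rho> u"
    have \<rho>: "\<rho> > 0" and sol: "is_sol n k p u" and u0: "u 0 = \<rho>"
      and du: "(u has_real_derivative 0) (at 0 within {0..})"
      using reg dim by (auto simp: regular_sol_def)
    have "(u \<longlongrightarrow> u 0) (at 0 within {0..})"
      using DERIV_continuous[OF du] by (simp add: continuous_within)
    then have lim: "(u \<longlongrightarrow> \<rho>) (at_right 0)"
      unfolding u0 by (rule tendsto_within_subset) auto
    interpret hessian_solution n k p u
    proof
      \<comment> \<open>A regular solution is bounded near the origin, hence negligible against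
        \<open>r powr - b\<close>.\<close>
      have "((\<lambda>r. r powr b) \<longlongrightarrow> 0) (at_right 0)"
        using b by (intro tendsto_eq_intros) (auto simp: eventually_at_filter)
      from tendsto_mult[OF lim this]
      show "((\<lambda>r. u r * r powr ((real n - 2 * real k) / real k)) \<longlongrightarrow> 0) (at_right 0)"
        by (simp add: b_def)
    qed (use k1 kn sol in auto)
    show "\<exists>R>0. stable_on TYPE('n) k p u R"
    proof (cases "p = p_so n k")
      case True
      have "real k * (real n - 2 * real k) < (real n + 2) * real k"
        using k0 by (simp add: algebra_simps add_pos_pos)
      then have "p > real k" using N by (simp add: True p_so_def pos_less_divide_eq)
      moreover obtain R where "R > 0" "\<And>r. r > R \<Longrightarrow> X r \<noteq> \<alpha>"
        using critical_avoids[OF lim \<rho> True] by blast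
      ultimately show ?thesis using stable_onI[OF dim, of R] by auto
    next
      case False
      with p have jl: "p_jl n k \<le> ereal p" by simp
      \<comment> \<open>A real \<open>p\<close> cannot dominate an infinite \<open>p_jl\<close>, so
        the finite branch applies.\<close>
      then have n8: "2 * k + 8 < n" by (simp add: p_jl_def split: if_splits)
      have Z0: "real n - 2 * real k - real k * \<alpha> = real k * (\<beta> - \<alpha>)"
        using k_beta by (simp add: algebra_simps)
      from p_jl_eigenslope[OF k1 n8 jl, folded \<alpha>_def, unfolded Z0]
      obtain \<mu> where \<mu>: "p > real k" "real k * (\<beta> - \<alpha>) > 0" "\<mu> > p"
        "\<mu>\<^sup>2 * \<alpha> / real k - \<mu> * (\<alpha> + real k * (\<beta> - \<alpha>)) + p * (real k * (\<beta> - \<alpha>)) = 0"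
        by blast
      have less: "X r < \<alpha>" if "r > 0" for r
        by (rule supercritical_X_less[OF lim \<rho> \<mu>(1) \<mu>(3) \<mu>(4) refl \<mu>(2) that])
      have "X r \<noteq> \<alpha>" if "r > 1" for r using less[of r] that by simp
      then show ?thesis using stable_onI[OF dim \<mu>(1), of 1] by (intro exI[of _ 1]) simp
    qed
  }
  fix U :: "real \<Rightarrow> real" and lam :: real
  assume p: "p_se n k < p \<and> p < p_so n k"
    and U: "is_sol n k p U \<and> ((\<lambda>r. U r / u_s n k p r) \<longlongrightarrow> 1) (at_right 0) \<and>
      lam > 0 \<and> ((\<lambda>r. U r * r powr ((real n - 2 * real k) / real k)) \<longlongrightarrow> lam) at_top"
  define a where "a = 2 * real k / (p - real k)"
  have "real k < p_se n k" using N k0 by (simp add: p_se_def field_simps)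
  with p have pk: "p > real k" by simp
  \<comment> \<open>For \<open>p > k\<close>, the condition \<open>p > p_se\<close> says that the
    scaling exponent lies below \<beta>.\<close>
  have "2 * real k * real k < (real n - 2 * real k) * (p - real k)"
    using p N by (simp add: p_se_def field_simps)
  then have ab: "a < b" using pk k0 N by (simp add: a_def b_def field_simps)
  \<comment> \<open>This allows recovering \<open>U\<close> from its quotient by \<open>u_s\<close>;
    the last base in \<open>A_const\<close> is positive because \<open>a < b\<close>.\<close>
  have A: "A_const n k p \<noteq> 0"
  proof -
    have "p * a = 2 * real k + real k * a" using pk by (simp add: a_def field_simps)
    moreover have "real k * a < real n - 2 * real k" using ab k0 by (simp add: b_def field_simps)
    ultimately have "real n - p * a > 0" by simp
    then have "real n - 2 * p * real k / (p - real k) \<noteq> 0" by (simp add: a_def mult_ac)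
    moreover have "Cnk n k > 0" using kn by (simp add: Cnk_def)
    ultimately show ?thesis using pk k0 by (simp add: A_const_def)
  qed
  interpret hessian_solution n k p U
  proof
    have us: "u_s n k p r = A_const n k p * r powr - a" for r by (simp add: u_s_def a_def)
    \<comment> \<open>\<open>U\<close> behaves like a multiple of \<open>r powr - a\<close> at the
      origin, and \<open>a < b\<close> makes this weaker than the excluded profile
      \<open>r powr - b\<close>.\<close>
    have "((\<lambda>r. r powr (b - a)) \<longlongrightarrow> 0) (at_right 0)"
      using ab by (intro tendsto_eq_intros) (auto simp: eventually_at_filter)
    then have "((\<lambda>r. U r / u_s n k p r * (A_const n k p * r powr (b - a))) \<longlongrightarrow> 1 * (A_const n k p * 0)) (at_right 0)"
      using U by (intro tendsto_intros) auto
    moreover have "eventually (\<lambda>r. U r / u_s n k p r * (A_const n k p * r powr (b - a)) = U r * r powr b) (at_right 0)"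
      using eventually_at_right_less[of 0]
      by eventually_elim (use A in \<open>simp add: us powr_diff powr_minus field_simps\<close>)
    ultimately have "((\<lambda>r. U r * r powr b) \<longlongrightarrow> 1 * (A_const n k p * 0)) (at_right 0)"
      by (rule Lim_transform_eventually)
    then show "((\<lambda>r. U r * r powr ((real n - 2 * real k) / real k)) \<longlongrightarrow> 0) (at_right 0)"
      by (simp add: b_def)
  qed (use k1 kn U in auto)
  have "\<alpha> < \<beta>" using ab by (simp add: \<alpha>_def \<beta>_def a_def b_def)
  then obtain R where "R > 0" "\<And>r. r > R \<Longrightarrow> X r \<noteq> \<alpha>"
    using fast_decay_avoids[of lam] U by (auto simp: \<beta>_def)
  then show "\<exists>R>0. stable_on TYPE('n) k p U R"
    using stable_onI[OF dim pk, of R] by auto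
qed

end
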